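(* For $q\in\{2,3,4\}$ let $I_q$ be the rate function of the large deviation principle with speed $n$ for $S_n/n$, where $S_n=\sum_{k=1}^n\cos(2\pi q^kU)$ and $U$ is uniform on $[0,1]$. Then, as $z\to0$, $$I_2(z)=z^2-z^3+\frac{3z^4}2-\frac{13z^5}6+\frac{29z^6}9-\frac{23z^7}5+\frac{1127z^8}{180}-\frac{29083z^9}{3780}+\frac{12077z^{10}}{1575}+O(z^{11}),$$ $$I_3(z)=z^2-\frac{z^4}{12}+\frac{z^6}6-\frac{39z^8}{320}+\frac{18113z^{10}}{100800}+O(z^{12}),$$ $$I_4(z)=z^2+\frac{z^4}4-\frac{z^5}{12}+\frac{5z^6}{36}+O(z^7).$$ In particular, the functions $I_2,I_3,I_4$ and $\widetilde I$ all differ from each other.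
   Context: For $q\in\{2,3,\ldots\}$, the rate function is $I_q(x)=\sup_{\theta\in\mathbb R}[\theta x-\Lambda_q(\theta)]$, $x\in\mathbb R$, where $\Lambda_q(\theta)=\lim_{n\to\infty}\frac1n\log\mathbb E[e^{\theta S_n}]$ (this limit exists for every $\theta\in\mathbb R$, uniformly on compact subsets of an open complex neighbourhood of $\mathbb R$, and $(S_n/n)_{n\in\mathbb N}$ satisfies a large deviation principle with speed $n$ and rate function $I_q$). The function $\widetilde I$ is $\widetilde I(x)=\sup_{\theta\in\mathbb R}[\theta x-\widetilde\Lambda(\theta)]$, where $\widetilde\Lambda(\theta)=\log\mathbb E[e^{\theta\cos(2\pi U)}]=\log\sum_{m=0}^\infty\frac{\theta^{2m}}{2^{2m}(m!)^2}$. *)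

theory Defs
  imports "HOL-Probability.Probability"
begin

definition S :: "('a \<Rightarrow> real) \<Rightarrow> nat \<Rightarrow> nat \<Rightarrow> 'a \<Rightarrow> real" where
  "S U q n \<omega> = (\<Sum>k=1..n. cos (2 * pi * real q ^ k * U \<omega>))"

definition Lambda :: "'a measure \<Rightarrow> ('a \<Rightarrow> real) \<Rightarrow> nat \<Rightarrow> real \<Rightarrow> real" where
  "Lambda M U q \<theta> = lim (\<lambda>n. ln (\<integral>\<omega>. exp (\<theta> * S U q n \<omega>) \<partial>M) / real n)"

definition Lambda_tilde :: "'a measure \<Rightarrow> ('a \<Rightarrow> real) \<Rightarrow> real \<Rightarrow> real" where
  "Lambda_tilde M U \<theta> = ln (\<integral>\<omega>. exp (\<theta> * cos (2 * pi * U \<omega>)) \<partial>M)"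

text \<open>The supremum is taken in the extended reals, since a rate function may take the value
  \<open>\<infinity>\<close>; here it does so outside \<open>[-1, 1]\<close>.\<close>

definition legendre :: "(real \<Rightarrow> real) \<Rightarrow> real \<Rightarrow> ereal" where
  "legendre L x = (SUP \<theta>. ereal (\<theta> * x - L \<theta>))"

text \<open>The Legendre transform of \<open>Lambda M U q\<close> is by definition the rate function of the large
  deviation principle with speed \<open>n\<close> for \<open>S U q n / n\<close>.\<close>

definition I :: "'a measure \<Rightarrow> ('a \<Rightarrow> real) \<Rightarrow> nat \<Rightarrow> real \<Rightarrow> ereal" where
  "I M U q = legendre (Lambda M U q)"

definition I_tilde :: "'a measure \<Rightarrow> ('a \<Rightarrow> real) \<Rightarrow> real \<Rightarrow> ereal" where
  "I_tilde M U = legendre (Lambda_tilde M U)"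

text \<open>\<open>f z = p z + O(z ^ N)\<close> as \<open>z \<rightarrow> 0\<close>, for an extended-real-valued \<open>f\<close>. Finiteness of \<open>f\<close> near
  \<open>0\<close> is part of the claim, because \<open>real_of_ereal\<close> maps infinite values to \<open>0\<close>.\<close>

definition expansion_at_0 :: "(real \<Rightarrow> ereal) \<Rightarrow> (real \<Rightarrow> real) \<Rightarrow> nat \<Rightarrow> bool" where
  "expansion_at_0 f p N \<longleftrightarrow>
     (\<forall>\<^sub>F z in at 0. \<bar>f z\<bar> \<noteq> \<infinity>) \<and>
     (\<lambda>z. real_of_ereal (f z) - p z) \<in> O[at 0](\<lambda>z. z ^ N)"

end

theory Submission
  imports Defs "HOL-Computational_Algebra.Polynomial" "HOL-Real_Asymp.Real_Asymp"
begin

text \<open>Let \<open>A f(x)\<close> be the mean of \<open>f\<close> over the \<open>q\<close> preimages of \<open>x\<close> under multiplication by \<open>q\<close> on the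
  circle. Since \<open>\<integral> f(x) g(q x) dx = \<integral> (A f) g\<close>, the exponential growth rate of \<open>E exp(\<theta> S\<^sub>n)\<close> is the
  leading eigenvalue of the positive operator \<open>w \<mapsto> A (exp(\<theta> cos) w)\<close>. For an approximate eigenfunction
  \<open>w \<approx> 1\<close>, a cosine polynomial in \<open>x\<close> and a polynomial in \<open>\<theta>\<close>, with residual \<open>O(\<theta>\<^sup>N)\<close> the inequalities
  \<open>(\<lambda> - \<epsilon>) w \<le> A (exp(\<theta> cos) w) \<le> (\<lambda> + \<epsilon>) w\<close> can be iterated, and give
  \<open>\<Lambda>(\<theta>) = ln \<lambda>(\<theta>) + O(\<theta>\<^sup>N)\<close>. Jensen's inequality \<open>n \<Lambda>(\<theta>) \<le> \<Lambda>(n \<theta>)\<close> confines the supremum in the Legendre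
  transform at \<open>z\<close> to \<open>\<theta> = O(z)\<close>, so the expansion of \<open>\<Lambda>\<close> at 0 determines that of the rate function.
  The limit defining \<open>\<Lambda>\<close> exists for all \<open>\<theta>\<close> by bounded distortion and Fekete's lemma.\<close>

subsection \<open>Legendre transforms\<close>

text \<open>Evaluation rules with which the simplifier decides the truncation conditions on the
  concrete polynomials \<open>P\<close>, \<open>T\<close> and \<open>J\<close> below.\<close>

lemma poly_cutoff_simps:
  fixes p :: "real poly"
  shows "poly_cutoff 0 p = 0" "poly_cutoff n (0::real poly) = 0"
    "poly_cutoff (Suc n) (pCons a p) = pCons a (poly_cutoff n p)"
    "poly_cutoff (numeral k) (pCons a p) = pCons a (poly_cutoff (pred_numeral k) p)"
  by (auto simp: poly_eq_iff coeff_poly_cutoff coeff_pCons numeral_eq_Suc split: nat.splits)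

text \<open>Every monomial that remains has degree at least \<open>N\<close>, so on the unit
  interval it is at most its coefficient times the \<open>N\<close>-th power. A finite check on
  coefficients thus becomes an analytic bound.\<close>

lemma poly_bigo_of_cutoff_0:
  fixes Q :: "real poly"
  assumes "poly_cutoff N Q = 0"
  obtains K where "K \<ge> 0" "\<And>z. \<bar>z\<bar> \<le> 1 \<Longrightarrow> \<bar>poly Q z\<bar> \<le> K * \<bar>z\<bar> ^ N"
proof -
  have c: "coeff Q i = 0" if "i < N" for i
    using assms that by (metis coeff_0 coeff_poly_cutoff)
  have "\<bar>poly Q z\<bar> \<le> (\<Sum>i\<le>degree Q. \<bar>coeff Q i\<bar>) * \<bar>z\<bar> ^ N" if z: "\<bar>z\<bar> \<le> 1" for z
  proof -
    have "\<bar>poly Q z\<bar> \<le> (\<Sum>i\<le>degree Q. \<bar>coeff Q i * z ^ i\<bar>)"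
      unfolding poly_altdef by (rule sum_abs)
    also have "\<dots> \<le> (\<Sum>i\<le>degree Q. \<bar>coeff Q i\<bar> * \<bar>z\<bar> ^ N)"
    proof (rule sum_mono)
      fix i
      show "\<bar>coeff Q i * z ^ i\<bar> \<le> \<bar>coeff Q i\<bar> * \<bar>z\<bar> ^ N"
      proof (cases "i < N")
        case False
        then have "\<bar>z\<bar> ^ i \<le> \<bar>z\<bar> ^ N" using z by (intro power_decreasing) auto
        then show ?thesis by (simp add: abs_mult power_abs mult_left_mono)
      qed (simp add: c)
    qed
    finally show ?thesis by (simp add: sum_distrib_right)
  qed
  then show ?thesis by (intro that[of "\<Sum>i\<le>degree Q. \<bar>coeff Q i\<bar>"]) (auto simp: sum_nonneg)
qed

text \<open>The second derivative of \<open>P\<close> at 0 is 1/2, so by continuity it stays above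
  3/8 nearby; half of that is the constant 3/16.\<close>

lemma strong_convexity_near_0:
  fixes P :: "real poly"
  assumes c2: "coeff P 2 = 1/4"
  obtains r where "0 < r" "r \<le> 1"
    "\<And>x y. \<bar>x\<bar> \<le> r \<Longrightarrow> \<bar>y\<bar> \<le> r \<Longrightarrow>
       poly P x \<ge> poly P y + poly (pderiv P) y * (x - y) + 3/16 * (x - y)^2"
proof -
  have "poly (pderiv (pderiv P)) 0 = 1/2"
    using c2 by (simp add: poly_0_coeff_0 coeff_pderiv numeral_2_eq_2)
  moreover have "isCont (poly (pderiv (pderiv P))) 0" by simp
  ultimately have "((poly (pderiv (pderiv P))) \<longlongrightarrow> 1/2) (at 0)" by (metis isCont_def)
  then have "\<forall>\<^sub>F x in at 0. poly (pderiv (pderiv P)) x > 3/8"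
    by (rule order_tendstoD) simp
  then obtain d where d: "d > 0" "\<And>x. x \<noteq> 0 \<Longrightarrow> \<bar>x\<bar> < d \<Longrightarrow> poly (pderiv (pderiv P)) x > 3/8"
    by (auto simp: eventually_at dist_real_def)
  then have d': "poly (pderiv (pderiv P)) x \<ge> 3/8" if "\<bar>x\<bar> < d" for x
    using that \<open>poly (pderiv (pderiv P)) 0 = 1/2\<close> by (cases "x = 0") force+
  define r where "r = min 1 (d / 2)"
  have r: "0 < r" "r \<le> 1" "r < d" using d by (auto simp: r_def)
  have "poly P x \<ge> poly P y + poly (pderiv P) y * (x - y) + 3/16 * (x - y)^2"
    if xy: "\<bar>x\<bar> \<le> r" "\<bar>y\<bar> \<le> r" for x y
  proof -
    \<comment> \<open>Removing the quadratic leaves a polynomial that is still convex on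
      \<open>{-r..r}\<close>; its tangent inequality at \<open>y\<close> is the claim.\<close>
    define G where "G = P - [:0,1:]^2 * [:3/16:]"
    have G: "poly G u = poly P u - 3/16 * u^2" for u by (simp add: G_def)
    have G1: "poly (pderiv G) u = poly (pderiv P) u - 3/8 * u" for u
      by (simp add: G_def pderiv_diff power2_eq_square pderiv_pCons)
    have G2: "poly (pderiv (pderiv G)) u = poly (pderiv (pderiv P)) u - 3/8" for u
      by (simp add: G_def pderiv_diff power2_eq_square pderiv_pCons)
    have "poly (pderiv G) y * (x - y) \<le> poly G x - poly G y"
    proof (rule f''_imp_f'[where C = "{-r..r}"])
      fix u assume "u \<in> {-r..r}"
      then have "\<bar>u\<bar> < d" using r by auto
      then show "0 \<le> poly (pderiv (pderiv G)) u" using d' G2 by simp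
    qed (use xy in \<open>auto intro: poly_DERIV\<close>)
    then show ?thesis unfolding G G1 by (simp add: power2_eq_square field_simps)
  qed
  with r show ?thesis using that by blast
qed


text \<open>\<open>T\<close> is an approximate maximiser and \<open>J\<close> the value there. Near
  a critical point an error of order \<open>M\<close> in the derivative costs only order
  \<open>2 * M\<close> in the value, hence \<open>N \<le> 2 * M\<close>. \<open>Lmult\<close> takes
  the place of convexity of \<open>L\<close> far from 0, where the expansion says nothing.\<close>

lemma legendre_expansion:
  fixes L :: "real \<Rightarrow> real" and P T J :: "real poly"
  assumes N: "3 \<le> N" "N \<le> 2 * M"
    and P: "coeff P 0 = 0" "coeff P 1 = 0" "coeff P 2 = 1/4"
    and L0: "L 0 = 0"
    and L: "(\<lambda>\<theta>. L \<theta> - poly P \<theta>) \<in> O[at 0](\<lambda>\<theta>. \<theta> ^ N)"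
    and Lmult: "\<And>n \<theta>. 0 < n \<Longrightarrow> real n * L \<theta> \<le> L (real n * \<theta>)"
    and T0: "coeff T 0 = 0"
    and J: "poly_cutoff N (pCons 0 T - pcompose P T - J) = 0"
    and T: "poly_cutoff M ([:0, 1:] - pcompose (pderiv P) T) = 0"
  shows "expansion_at_0 (legendre L) (poly J) N"
proof -
  obtain r where r: "0 < r" "r \<le> 1"
    and conv: "\<And>x y. \<bar>x\<bar> \<le> r \<Longrightarrow> \<bar>y\<bar> \<le> r \<Longrightarrow>
       poly P x \<ge> poly P y + poly (pderiv P) y * (x - y) + 3/16 * (x - y)^2"
    using strong_convexity_near_0[OF P(3)] by blast
  obtain C where C: "C > 0" "\<forall>\<^sub>F \<theta> in at 0. norm (L \<theta> - poly P \<theta>) \<le> C * norm (\<theta> ^ N)"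
    using landau_o.bigE[OF L] by blast
  then obtain d where d: "d > 0"
    "\<And>\<theta>. \<theta> \<noteq> 0 \<Longrightarrow> \<bar>\<theta>\<bar> < d \<Longrightarrow> \<bar>L \<theta> - poly P \<theta>\<bar> \<le> C * \<bar>\<theta>\<bar> ^ N"
    by (auto simp: eventually_at dist_real_def power_abs)
  have P0: "poly P 0 = 0" "poly (pderiv P) 0 = 0"
    using P by (simp_all add: poly_0_coeff_0 coeff_pderiv)
  have err: "\<bar>L \<theta> - poly P \<theta>\<bar> \<le> C * \<bar>\<theta>\<bar> ^ N" if "\<bar>\<theta>\<bar> < d" for \<theta>
    using d(2)[OF _ that] C(1) L0 P0 by (cases "\<theta> = 0") auto
  obtain K1 where K1: "K1 \<ge> 0" "\<And>z. \<bar>z\<bar> \<le> 1 \<Longrightarrow>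
      \<bar>z * poly T z - poly P (poly T z) - poly J z\<bar> \<le> K1 * \<bar>z\<bar> ^ N"
    using poly_bigo_of_cutoff_0[OF J] by (auto simp: poly_pcompose)
  obtain K2 where K2: "K2 \<ge> 0" "\<And>z. \<bar>z\<bar> \<le> 1 \<Longrightarrow>
      \<bar>z - poly (pderiv P) (poly T z)\<bar> \<le> K2 * \<bar>z\<bar> ^ M"
    using poly_bigo_of_cutoff_0[OF T] by (auto simp: poly_pcompose)
  have "poly_cutoff 1 T = 0" using T0 by (auto simp: poly_eq_iff coeff_poly_cutoff)
  then obtain K3 where K3: "K3 \<ge> 0" "\<And>z. \<bar>z\<bar> \<le> 1 \<Longrightarrow> \<bar>poly T z\<bar> \<le> K3 * \<bar>z\<bar>"
    using poly_bigo_of_cutoff_0[of 1 T] by (metis power_one_right)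
  \<comment> \<open>Up to \<open>\<delta>\<close> strong convexity and the error bound both hold,
    and 1/(16 C) makes the error at most one sixteenth of the square of \<theta>.\<close>
  define \<delta> where "\<delta> = min r (min (d / 2) (1 / (16 * C)))"
  have \<delta>: "0 < \<delta>" "\<delta> \<le> r" "\<delta> < d" "\<delta> \<le> 1" "C * \<delta> \<le> 1/16"
  proof -
    have "\<delta> \<le> 1 / (16 * C)" by (simp add: \<delta>_def)
    then show "C * \<delta> \<le> 1/16" using C(1) by (simp add: field_simps)
  qed (use r d(1) C(1) in \<open>auto simp: \<delta>_def min_less_iff_disj min_le_iff_disj\<close>)
  \<comment> \<open>The summands pay, in this order, for replacing \<open>V\<close> by
    \<open>J\<close>, for the inexact critical point, for replacing \<open>L\<close> by
    \<open>P\<close> when \<open>\<bar>\<theta>\<bar> \<le> 8 * \<bar>z\<bar>\<close>, and for the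
    same replacement at the point \<open>T z\<close>.\<close>
  define K where "K = K1 + 2 * K2\<^sup>2 + C * 8 ^ N + C * K3 ^ N"
  \<comment> \<open>The bound \<delta>/32 puts \<open>8 * \<bar>z\<bar>\<close> below \<delta>/2,
    and the last term puts \<open>T z\<close> into the range of strong convexity.\<close>
  define z0 where "z0 = min 1 (min (\<delta> / 32) (\<delta> / (K3 + 1)))"
  have z0: "0 < z0" "z0 \<le> 1" "16 * z0 < \<delta>" "K3 * z0 \<le> \<delta>"
    using \<delta>(1) K3(1) by (auto simp: z0_def min_def field_simps)
  have main: "\<bar>legendre L z\<bar> \<noteq> \<infinity> \<and> \<bar>real_of_ereal (legendre L z) - poly J z\<bar> \<le> K * \<bar>z\<bar> ^ N"
    if z: "\<bar>z\<bar> < z0" for z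
  proof -
    define t where "t = poly T z"
    define e where "e = z - poly (pderiv P) t"
    define V where "V = t * z - poly P t"
    have z1: "\<bar>z\<bar> \<le> 1" "16 * \<bar>z\<bar> < \<delta>" using z z0 by auto
    have "K3 * \<bar>z\<bar> \<le> K3 * z0" using z K3(1) by (intro mult_left_mono) auto
    then have t: "\<bar>t\<bar> \<le> K3 * \<bar>z\<bar>" "\<bar>t\<bar> \<le> \<delta>"
      using K3(2)[OF z1(1)] z0 by (auto simp: t_def)
    have VJ: "\<bar>V - poly J z\<bar> \<le> K1 * \<bar>z\<bar> ^ N"
      using K1(2)[OF z1(1)] by (simp add: V_def t_def mult.commute)
    have "\<bar>e\<bar> \<le> K2 * \<bar>z\<bar> ^ M" using K2(2)[OF z1(1)] by (simp add: e_def t_def)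
    then have "e\<^sup>2 \<le> (K2 * \<bar>z\<bar> ^ M)\<^sup>2" by (metis abs_ge_zero power2_abs power_mono)
    also have "\<dots> = K2\<^sup>2 * \<bar>z\<bar> ^ (2 * M)" by (simp add: power_mult_distrib mult.commute flip: power_mult)
    also have "\<dots> \<le> K2\<^sup>2 * \<bar>z\<bar> ^ N" using N z1 by (intro mult_left_mono power_decreasing) auto
    finally have e2: "e\<^sup>2 \<le> K2\<^sup>2 * \<bar>z\<bar> ^ N" .
    \<comment> \<open>By strong convexity an optimiser that is accurate to order \<open>M\<close> yields the supremum to order \<open>2M\<close>.\<close>
    have Pub: "\<theta> * z - poly P \<theta> \<le> V + 2 * e\<^sup>2" if "\<bar>\<theta>\<bar> \<le> \<delta>" for \<theta>
    proof -
      have "poly P \<theta> \<ge> poly P t + poly (pderiv P) t * (\<theta> - t) + 3/16 * (\<theta> - t)^2"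
        using conv[of \<theta> t] that t \<delta> by simp
      then have "\<theta> * z - poly P \<theta> \<le> V + (\<theta> - t) * e - 3/16 * (\<theta> - t)^2"
        by (simp add: V_def e_def algebra_simps)
      \<comment> \<open>With u = \<theta> - t, the square of e - u/4 gives u e \<le> 2 e^2 + u^2/8,
        and 1/8 is less than 3/16.\<close>
      also have "\<dots> \<le> V + 2 * e\<^sup>2"
        using zero_le_power2[of "e - (\<theta> - t) / 4"] zero_le_power2[of "\<theta> - t"]
        by (simp add: power2_eq_square field_simps)
      finally show ?thesis .
    qed
    \<comment> \<open>Here \<open>L\<close> is at least (3/16 - 1/16) times the square of \<theta>,
      while \<open>\<theta> * z\<close> is at most 1/8 of that square.\<close>
    have Lpos: "\<theta> * z - L \<theta> \<le> 0" if \<theta>: "\<bar>\<theta>\<bar> \<le> \<delta>" "8 * \<bar>z\<bar> \<le> \<bar>\<theta>\<bar>" for \<theta>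
    proof -
      have "C * \<bar>\<theta>\<bar> ^ N \<le> C * \<bar>\<theta>\<bar> ^ 3"
        using N C(1) \<theta>(1) \<delta> by (intro mult_left_mono power_decreasing) auto
      also have "\<dots> = (C * \<bar>\<theta>\<bar>) * \<theta>\<^sup>2" by (simp add: power3_eq_cube power2_eq_square)
      also have "\<dots> \<le> (C * \<delta>) * \<theta>\<^sup>2" using C(1) \<theta>(1) by (intro mult_right_mono mult_left_mono) auto
      also have "\<dots> \<le> 1/16 * \<theta>\<^sup>2" using \<delta> by (intro mult_right_mono) auto
      finally have 1: "L \<theta> \<ge> poly P \<theta> - 1/16 * \<theta>\<^sup>2" using err[of \<theta>] \<theta>(1) \<delta> by auto
      have "poly P \<theta> \<ge> 3/16 * \<theta>\<^sup>2" using conv[of \<theta> 0] \<theta>(1) \<delta> P0 r by simp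
      moreover have "\<theta> * z \<le> \<bar>\<theta>\<bar> * (\<bar>\<theta>\<bar> / 8)"
        using \<theta>(2) by (metis abs_ge_self abs_ge_zero abs_mult le_divide_eq_numeral1(1) mult.commute mult_left_mono order_trans)
      ultimately show ?thesis using 1 by (simp add: power2_eq_square)
    qed
    have ub: "\<theta> * z - L \<theta> \<le> V + 2 * e\<^sup>2 + C * 8 ^ N * \<bar>z\<bar> ^ N" for \<theta>
    proof -
      \<comment> \<open>The competitor \<theta> = 0 has value 0, so any \<theta> with nonpositive
        value respects the upper bound.\<close>
      have pos: "0 \<le> V + 2 * e\<^sup>2" using Pub[of 0] \<delta> P0 by simp
      have pos': "0 \<le> C * 8 ^ N * \<bar>z\<bar> ^ N" using C(1) by simp
      consider "\<bar>\<theta>\<bar> \<le> 8 * \<bar>z\<bar>" | "8 * \<bar>z\<bar> \<le> \<bar>\<theta>\<bar>" "\<bar>\<theta>\<bar> \<le> \<delta>" | "\<delta> < \<bar>\<theta>\<bar>" by linarith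
      then show ?thesis
      proof cases
        case 1
        then have "C * \<bar>\<theta>\<bar> ^ N \<le> C * (8 * \<bar>z\<bar>) ^ N" using C(1) by (intro mult_left_mono power_mono) auto
        moreover have "\<bar>\<theta>\<bar> \<le> \<delta>" using 1 z1 by simp
        ultimately show ?thesis using Pub[of \<theta>] err[of \<theta>] \<delta> by (simp add: power_mult_distrib)
      next
        case 2
        then show ?thesis using Lpos pos pos' by fastforce
      next
        case 3
        \<comment> \<open>Scale \<open>\<theta>\<close> down by an integer into \<open>[\<delta>/2, \<delta>]\<close>, where \<open>Lpos\<close> applies.\<close>
        define n where "n = nat \<lceil>\<bar>\<theta>\<bar> / \<delta>\<rceil>"
        have q: "\<bar>\<theta>\<bar> / \<delta> > 1" using 3 \<delta> by simp
        have n: "real n \<ge> \<bar>\<theta>\<bar> / \<delta>" "real n < \<bar>\<theta>\<bar> / \<delta> + 1" unfolding n_def using q by linarith+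
        have n0: "real n > 0" using n q by linarith
        define \<phi> where "\<phi> = \<theta> / real n"
        have a: "\<bar>\<phi>\<bar> = \<bar>\<theta>\<bar> / real n" by (simp add: \<phi>_def)
        have "\<bar>\<phi>\<bar> \<le> \<delta>" using n n0 \<delta> by (simp add: a field_simps)
        moreover have "real n \<le> 2 * (\<bar>\<theta>\<bar> / \<delta>)" using n q by linarith
        then have "\<delta> / 2 \<le> \<bar>\<phi>\<bar>" using n0 \<delta> by (simp add: a field_simps)
        ultimately have "\<phi> * z - L \<phi> \<le> 0" using z1 by (intro Lpos) auto
        moreover have "real n * L \<phi> \<le> L (real n * \<phi>)" using n0 by (intro Lmult) auto
        moreover have "real n * \<phi> = \<theta>" using n0 by (simp add: \<phi>_def)
        moreover have "real n * (\<phi> * z - L \<phi>) \<le> 0"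
          using calculation(1) n0 by (simp add: mult_le_0_iff)
        ultimately have "\<theta> * z - L \<theta> \<le> 0"
          by (simp add: algebra_simps) (metis mult.assoc mult.commute order_trans)
        then show ?thesis using pos pos' by linarith
      qed
    qed
    have leg_le: "legendre L z \<le> ereal (V + 2 * e\<^sup>2 + C * 8 ^ N * \<bar>z\<bar> ^ N)"
      unfolding legendre_def by (rule SUP_least) (use ub in simp)
    have "C * \<bar>t\<bar> ^ N \<le> C * (K3 * \<bar>z\<bar>) ^ N" using C(1) t by (intro mult_left_mono power_mono) auto
    then have "V - C * K3 ^ N * \<bar>z\<bar> ^ N \<le> t * z - L t"
      using err[of t] t \<delta> by (simp add: V_def power_mult_distrib)
    also have "ereal (t * z - L t) \<le> legendre L z"
      unfolding legendre_def by (rule SUP_upper) simp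
    finally have leg_ge: "ereal (V - C * K3 ^ N * \<bar>z\<bar> ^ N) \<le> legendre L z" by simp
    from leg_le leg_ge obtain l where l: "legendre L z = ereal l" by (cases "legendre L z") auto
    have "C * 8 ^ N * \<bar>z\<bar> ^ N \<ge> 0" "C * K3 ^ N * \<bar>z\<bar> ^ N \<ge> 0" "K2\<^sup>2 * \<bar>z\<bar> ^ N \<ge> 0" using C(1) K3(1) by simp_all
    moreover have "K * \<bar>z\<bar> ^ N = K1 * \<bar>z\<bar> ^ N + 2 * (K2\<^sup>2 * \<bar>z\<bar> ^ N) + C * 8 ^ N * \<bar>z\<bar> ^ N + C * K3 ^ N * \<bar>z\<bar> ^ N"
      by (simp add: K_def algebra_simps)
    moreover have "l \<le> V + 2 * e\<^sup>2 + C * 8 ^ N * \<bar>z\<bar> ^ N" "V - C * K3 ^ N * \<bar>z\<bar> ^ N \<le> l"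
      using leg_le leg_ge by (simp_all add: l)
    ultimately have "\<bar>l - poly J z\<bar> \<le> K * \<bar>z\<bar> ^ N"
      using VJ e2 unfolding abs_le_iff by linarith
    then show ?thesis by (simp add: l)
  qed
  have near: "\<forall>\<^sub>F z in at 0. \<bar>z\<bar> < z0"
    using z0(1) by (auto simp: eventually_at dist_real_def)
  have ev: "\<forall>\<^sub>F z in at 0. \<bar>legendre L z\<bar> \<noteq> \<infinity> \<and>
      norm (real_of_ereal (legendre L z) - poly J z) \<le> K * norm (z ^ N)"
    using near
  proof eventually_elim
    case (elim z)
    show ?case unfolding real_norm_def power_abs using main[OF elim] .
  qed
  show ?thesis unfolding expansion_at_0_def
  proof
    show "\<forall>\<^sub>F z in at 0. \<bar>legendre L z\<bar> \<noteq> \<infinity>"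
      using ev by (rule eventually_mono) (erule conjunct1)
    show "(\<lambda>z. real_of_ereal (legendre L z) - poly J z) \<in> O[at 0](\<lambda>z. z ^ N)"
      by (rule bigoI[where c = K], rule eventually_mono[OF ev], erule conjunct2)
  qed
qed

subsection \<open>The averaging operator\<close>

lemma integral_0_of_nat:
  fixes h :: "real \<Rightarrow> real"
  assumes h: "continuous_on UNIV h"
  shows "integral {0..real m} h = (\<Sum>j<m. integral {0..1} (\<lambda>x. h (x + real j)))"
proof (induction m)
  case (Suc m)
  have i: "h integrable_on {a..b}" for a b
    using h by (intro integrable_continuous_real) (blast intro: continuous_on_subset)
  have "(h has_integral integral {real m..real m + 1} h) (cbox (real m) (real m + 1))"
    using i by (simp add: has_integral_integral)
  from has_integral_affinity'[OF this, of 1 "real m"]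
  have "integral {0..1} (\<lambda>x. h (x + real m)) = integral {real m..real m + 1} h"
    by (simp add: integral_unique)
  moreover have "integral {0..real m} h + integral {real m..real m + 1} h = integral {0..real m + 1} h"
    using i by (intro Henstock_Kurzweil_Integration.integral_combine) auto
  ultimately show ?case using Suc by (simp add: add.commute)
qed simp

text \<open>\<open>mean_op q\<close> is the adjoint of composition with the \<open>q\<close>-fold cover \<open>x \<mapsto> q x\<close> of the circle.\<close>

definition mean_op :: "nat \<Rightarrow> (real \<Rightarrow> real) \<Rightarrow> real \<Rightarrow> real" where
  "mean_op q f x = (\<Sum>j<q. f ((x + real j) / real q)) / real q"

lemma periodic_of_nat:
  fixes g :: "real \<Rightarrow> real"
  assumes "\<And>x. g (x + 1) = g x"
  shows "g (x + real j) = g x"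
  by (induction j) (auto simp: assms add.assoc[symmetric] add.commute[of 1])

text \<open>Rescaling by \<open>q\<close> turns the left side into an integral over
  \<open>{0..q}\<close>. On each of its \<open>q\<close> unit pieces \<open>g\<close> repeats
  itself, and the pieces of \<open>f\<close> add up to the mean over the preimages.\<close>

lemma integral_mult_periodic:
  fixes f g :: "real \<Rightarrow> real"
  assumes q: "0 < q" and f: "continuous_on UNIV f" and g: "continuous_on UNIV g"
    and per: "\<And>x. g (x + 1) = g x"
  shows "integral {0..1} (\<lambda>x. f x * g (real q * x)) = integral {0..1} (\<lambda>x. mean_op q f x * g x)"
proof -
  define h where "h = (\<lambda>x. f (x / real q) * g x)"
  have f': "continuous_on S (\<lambda>x. f (k x))" if "continuous_on S k" for S and k :: "real \<Rightarrow> real"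
    using continuous_on_compose2[OF f that] by simp
  have g': "continuous_on S (\<lambda>x. g (k x))" if "continuous_on S k" for S and k :: "real \<Rightarrow> real"
    using continuous_on_compose2[OF g that] by simp
  have h: "continuous_on UNIV h" unfolding h_def using q by (intro continuous_intros f' g') auto
  have "h integrable_on {0..real q}"
    using h by (intro integrable_continuous_real) (blast intro: continuous_on_subset)
  then have "(h has_integral integral {0..real q} h) (cbox 0 (real q))"
    by (simp add: has_integral_integral)
  from has_integral_affinity'[OF this, of "real q" 0] q
  have "((\<lambda>x. h (real q * x)) has_integral integral {0..real q} h / real q) {0..1}"
    by (simp add: divide_inverse mult.commute)
  moreover have "h (real q * x) = f x * g (real q * x)" for x using q by (simp add: h_def)
  ultimately have "integral {0..1} (\<lambda>x. f x * g (real q * x)) = integral {0..real q} h / real q"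
    by (simp add: integral_unique)
  also have "integral {0..real q} h = (\<Sum>j<q. integral {0..1} (\<lambda>x. f ((x + real j) / real q) * g x))"
    unfolding integral_0_of_nat[OF h] by (simp add: h_def periodic_of_nat[of g, OF per])
  also have "\<dots> = integral {0..1} (\<lambda>x. \<Sum>j<q. f ((x + real j) / real q) * g x)"
    by (subst integral_sum) (auto intro!: integrable_continuous_real continuous_intros f' g' simp: q)
  also have "\<dots> / real q = integral {0..1} (\<lambda>x. (\<Sum>j<q. f ((x + real j) / real q) * g x) / real q)"
    by simp
  also have "\<dots> = integral {0..1} (\<lambda>x. mean_op q f x * g x)"
    by (intro integral_cong) (simp add: mean_op_def sum_distrib_right)
  finally show ?thesis .
qed

text \<open>The limit is the infimum of \<open>u n / real n\<close> over \<open>n \<ge> 1\<close>,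
  which the linear lower bound keeps finite. Division with remainder by a nearly optimal
  \<open>m\<close> gives the upper estimate.\<close>

lemma fekete:
  fixes u :: "nat \<Rightarrow> real"
  assumes sub: "\<And>m n. u (m + n) \<le> u m + u n" and lower: "\<And>n. - (B * real n) \<le> u n"
  shows "convergent (\<lambda>n. u n / real n)"
proof -
  define l where "l = Inf ((\<lambda>n. u n / real n) ` {1..})"
  have bdd: "bdd_below ((\<lambda>n. u n / real n) ` {1..})"
  proof (rule bdd_belowI2)
    fix n :: nat assume "n \<in> {1..}"
    then show "- B \<le> u n / real n" using lower[of n] by (simp add: field_simps)
  qed
  have l_le: "l \<le> u n / real n" if "n \<ge> 1" for n
    unfolding l_def using bdd that by (intro cInf_lower) auto
  have mult: "u (m * k + r) \<le> real k * u m + u r" for m k r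
  proof (induction k)
    case (Suc k)
    have "u (m + (m * k + r)) \<le> u m + u (m * k + r)" by (rule sub)
    then show ?case using Suc by (simp add: algebra_simps)
  qed simp
  have "(\<lambda>n. u n / real n) \<longlonglongrightarrow> l"
  proof (rule LIMSEQ_I)
    fix e :: real assume e: "e > 0"
    have "\<exists>y\<in>(\<lambda>n. u n / real n) ` {1..}. y < l + e / 2"
      unfolding l_def using bdd e by (subst cInf_less_iff[symmetric]) auto
    then obtain m where m: "m \<ge> 1" "u m / real m < l + e / 2" by auto
    \<comment> \<open>The first term bounds the remainder block \<open>u r\<close>; the second pays
      for replacing k = (n - r)/m by n/m.\<close>
    define R where "R = Max ((\<lambda>r. \<bar>u r\<bar>) ` {..<m}) + real m * \<bar>u m\<bar> "
    have R: "\<bar>u r\<bar> + real m * \<bar>u m\<bar> \<le> R" if "r < m" for r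
      unfolding R_def using that by (intro add_right_mono Max_ge) auto
    have R0: "R \<ge> 0" using R[of 0] m by (meson abs_ge_zero add_nonneg_nonneg mult_nonneg_nonneg of_nat_0_le_iff order_trans less_le_trans zero_less_one)
    obtain n0 where n0: "real n0 > 2 * R / e" using reals_Archimedean2 by blast
    have "norm (u n / real n - l) < e" if n: "n \<ge> max 1 n0" for n
    proof -
      define k r where "k = n div m" and "r = n mod m"
      have nk: "n = m * k + r" and r: "r < m" using m by (auto simp: k_def r_def)
      have "real m * u n \<le> real m * (real k * u m + u r)"
        using mult[of m k r] nk by (intro mult_left_mono) auto
      also have "\<dots> = (real n - real r) * u m + real m * u r" by (simp add: nk algebra_simps)
      also have "\<dots> \<le> real n * u m + real m * R"
      proof -
        have "- (real r * u m) \<le> real r * \<bar>u m\<bar>"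
          by (metis abs_ge_minus_self mult_left_mono mult_minus_right of_nat_0_le_iff)
        also have "\<dots> \<le> real m * (real m * \<bar>u m\<bar>)"
        proof (rule mult_mono)
          have "1 * \<bar>u m\<bar> \<le> real m * \<bar>u m\<bar>" using m by (intro mult_right_mono) auto
          then show "\<bar>u m\<bar> \<le> real m * \<bar>u m\<bar>" by simp
        qed (use r in auto)
        finally have "- (real r * u m) + real m * u r \<le> real m * (\<bar>u r\<bar> + real m * \<bar>u m\<bar>)"
          using mult_left_mono[OF abs_ge_self, of "real m" "u r"] by (simp add: algebra_simps)
        also have "\<dots> \<le> real m * R" using R[OF r] by (intro mult_left_mono) auto
        finally show ?thesis by (simp add: algebra_simps)
      qed
      finally have "u n / real n \<le> u m / real m + R / real n"
        using m n by (simp add: field_simps)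
      also have "R / real n < e / 2"
      proof -
        have "2 * R / e < real n" using n0 n by linarith
        then show ?thesis using e n by (simp add: field_simps)
      qed
      finally have "u n / real n < l + e" using m by simp
      then show ?thesis using l_le[of n] n by (simp add: abs_if)
    qed
    then show "\<exists>no. \<forall>n\<ge>no. norm (u n / real n - l) < e" by blast
  qed
  then show ?thesis by (rule convergentI)
qed

section \<open>Cosine polynomials under averaging and under multiplication by the cosine\<close>

lemma cos_add_2pi_of_nat: "cos (x + 2 * pi * real n) = cos x"
  using cos.plus_of_nat[of x n] by (simp add: mult.commute mult.left_commute)

text \<open>If \<open>q\<close> divides \<open>k\<close>, all \<open>q\<close> summands coincide.
  Otherwise they are real parts of a fixed phase times the powers of a nontrivial
  \<open>q\<close>-th root of unity, and the geometric sum vanishes.\<close>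

lemma mean_op_cos:
  assumes q: "0 < q"
  shows "mean_op q (\<lambda>x. cos (2 * pi * real k * x)) x =
    (if q dvd k then cos (2 * pi * real (k div q) * x) else 0)"
proof (cases "q dvd k")
  case True
  then obtain m where k: "k = q * m" by blast
  have "cos (2 * pi * real k * ((x + real j) / real q)) = cos (2 * pi * real m * x)" for j
  proof -
    have "2 * pi * real k * ((x + real j) / real q) = 2 * pi * real m * x + 2 * pi * real (m * j)"
      using q by (simp add: k field_simps)
    then show ?thesis by (simp only: cos_add_2pi_of_nat)
  qed
  then show ?thesis using q by (simp add: mean_op_def k)
next
  case False
  define \<omega> where "\<omega> = cis (2 * pi * real k / real q)"
  have "real q * (2 * pi * real k / real q) = 2 * pi * real k" using q by simp
  then have "\<omega> ^ q = cis (2 * pi * real k)" by (simp only: \<omega>_def Complex.DeMoivre)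
  also have "\<dots> = 1" by (rule cis_multiple_2pi) simp
  finally have one: "\<omega> ^ q = 1" .
  have "\<omega> \<noteq> 1"
  proof
    assume "\<omega> = 1"
    then have "cos (2 * pi * real k / real q) = 1" by (simp add: \<omega>_def complex_eq_iff)
    then obtain n :: int where "2 * pi * real k / real q = of_int n * 2 * pi"
      by (auto simp: cos_one_2pi_int)
    then have "real k = of_int n * real q" using q by (simp add: field_simps)
    then have "int k = n * int q" by (metis of_int_eq_iff of_int_mult of_int_of_nat_eq)
    then have "int q dvd int k" by simp
    with False show False by simp
  qed
  with one have s: "(\<Sum>j<q. \<omega> ^ j) = 0" by (simp add: geometric_sum)
  have "cos (2 * pi * real k * ((x + real j) / real q)) = Re (cis (2 * pi * real k * x / real q) * \<omega> ^ j)" for j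
  proof -
    have "2 * pi * real k * ((x + real j) / real q) = 2 * pi * real k * x / real q + real j * (2 * pi * real k / real q)"
      by (simp add: add_divide_distrib ring_distribs mult_ac)
    then show ?thesis by (simp only: \<omega>_def Complex.DeMoivre cis_mult cis.sel)
  qed
  then have "(\<Sum>j<q. cos (2 * pi * real k * ((x + real j) / real q)))
      = Re (cis (2 * pi * real k * x / real q) * (\<Sum>j<q. \<omega> ^ j))"
    by (simp only: sum_distrib_left Re_sum)
  with s False show ?thesis by (simp add: mean_op_def)
qed

lemma mean_op_add: "mean_op q (\<lambda>x. f x + g x) x = mean_op q f x + mean_op q g x"
  by (simp add: mean_op_def sum.distrib add_divide_distrib)

lemma mean_op_cmult: "mean_op q (\<lambda>x. c * f x) x = c * mean_op q f x"
  by (simp add: mean_op_def sum_distrib_left)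

lemma mean_op_sum: "mean_op q (\<lambda>x. \<Sum>i\<in>A. f i x) x = (\<Sum>i\<in>A. mean_op q (f i) x)"
  by (simp add: mean_op_def sum.swap[of _ A] sum_divide_distrib)

lemma mean_op_abs_diff_le:
  assumes q: "0 < q" and le: "\<And>x. \<bar>f x - g x\<bar> \<le> c"
  shows "\<bar>mean_op q f x - mean_op q g x\<bar> \<le> c"
proof -
  have "\<bar>\<Sum>j<q. f ((x + real j) / real q) - g ((x + real j) / real q)\<bar> \<le> (\<Sum>j<q. c)"
    by (rule order_trans[OF sum_abs]) (intro sum_mono le)
  then show ?thesis using q
    by (simp add: mean_op_def sum_subtractf field_simps flip: diff_divide_distrib)
qed

text \<open>A cosine polynomial is stored as its coefficients from frequency \<open>k\<close>
  upwards. All operators then become list recursions that the simplifier can run, and the offset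
  \<open>k\<close> carries the inductions.\<close>

fun cos_series :: "nat \<Rightarrow> real list \<Rightarrow> real \<Rightarrow> real" where
  "cos_series k [] x = 0"
| "cos_series k (a # as) x = a * cos (2 * pi * real k * x) + cos_series (Suc k) as x"

fun list_plus :: "real list \<Rightarrow> real list \<Rightarrow> real list" where
  "list_plus [] bs = bs"
| "list_plus (a # as) [] = a # as"
| "list_plus (a # as) (b # bs) = (a + b) # list_plus as bs"

lemma cos_series_list_plus:
  "cos_series k (list_plus as bs) x = cos_series k as x + cos_series k bs x"
  by (induction as bs arbitrary: k rule: list_plus.induct) (auto simp: algebra_simps)

lemma cos_series_scale: "cos_series k (map ((*) c) as) x = c * cos_series k as x"
  by (induction as arbitrary: k) (auto simp: algebra_simps)

text \<open>\<open>mean_op q\<close> kills all harmonics that are not divisible by \<open>q\<close>.\<close>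

fun decimate :: "nat \<Rightarrow> nat \<Rightarrow> real list \<Rightarrow> real list" where
  "decimate q n [] = []"
| "decimate q 0 (a # as) = a # decimate q (q - 1) as"
| "decimate q (Suc n) (a # as) = decimate q n as"

text \<open>The counter \<open>n\<close> is the distance from the current frequency \<open>k\<close>
  to the next multiple of \<open>q\<close>; after a coefficient is kept it restarts at
  \<open>q - 1\<close>.\<close>

lemma mean_op_cos_series:
  assumes q: "0 < q"
  shows "n < q \<Longrightarrow> q dvd k + n \<Longrightarrow> mean_op q (cos_series k as) x = cos_series ((k + n) div q) (decimate q n as) x"
proof (induction q n as arbitrary: k rule: decimate.induct)
  case (1 q n)
  then show ?case by (simp add: mean_op_def)
next
  case (2 q a as)
  then obtain m where k: "k = q * m" by auto
  have "mean_op q (cos_series (Suc k) as) x = cos_series ((Suc k + (q - 1)) div q) (decimate q (q - 1) as) x"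
    using 2 by (intro "2.IH") auto
  moreover have "Suc k + (q - 1) = q * Suc m" using 2 by (simp add: k)
  ultimately have "mean_op q (cos_series (Suc k) as) x = cos_series (Suc m) (decimate q (q - 1) as) x"
    using 2(2) by simp
  moreover have "q dvd k" "k div q = m" using 2(2) by (auto simp: k)
  ultimately show ?case using 2(2) by (simp add: mean_op_add mean_op_cmult mean_op_cos)
next
  case (3 q n a as)
  have "\<not> q dvd k"
  proof
    assume "q dvd k"
    then have "q dvd Suc n" using 3(3) dvd_add_right_iff by blast
    then show False using 3(2) by (auto dest: dvd_imp_le)
  qed
  then show ?case using 3 by (simp add: mean_op_add mean_op_cmult mean_op_cos)
qed

text \<open>The product formula makes multiplication by the cosine half the sum of a right and a
  left shift. The constant term has no left neighbour, so \<open>[0, a]\<close> supplies the second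
  half of its contribution at frequency 1.\<close>

fun times_cos :: "real list \<Rightarrow> real list" where
  "times_cos [] = []"
| "times_cos (a # as) = map ((*) (1/2)) (list_plus (0 # a # as) (list_plus [0, a] as))"

text \<open>The series starts at a positive frequency, so that the left shift never drops below
  frequency 0.\<close>

lemma cos_times_cos_series:
  "2 * (cos (2 * pi * x) * cos_series (Suc k) as x) = cos_series (Suc (Suc k)) as x + cos_series k as x"
proof (induction as arbitrary: k)
  case (Cons a as)
  have "2 * (cos (2 * pi * x) * cos (2 * pi * real (Suc k) * x))
      = cos (2 * pi * real (Suc (Suc k)) * x) + cos (2 * pi * real k * x)"
    by (subst cos_times_cos) (simp add: algebra_simps)
  then show ?case using Cons[of "Suc k"] by (simp only: cos_series.simps) algebra
qed simp

lemma cos_series_times_cos: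
  "cos_series 0 (times_cos as) x = cos (2 * pi * x) * cos_series 0 as x"
proof (cases as)
  case (Cons a as')
  show ?thesis
    using cos_times_cos_series[of x 0 as']
    by (simp add: Cons cos_series_scale cos_series_list_plus algebra_simps del: list_plus.simps)
qed simp

subsection \<open>Existence of the limiting cumulant generating function\<close>

text \<open>Moves the problem from the abstract probability space to the unit interval, where
  \<open>integral_mult_periodic\<close> applies.\<close>

lemma expectation_uniform:
  fixes f :: "real \<Rightarrow> real"
  assumes U: "U \<in> borel_measurable M"
    and D: "distr M borel U = uniform_measure lborel {0..1}"
    and f: "continuous_on UNIV f"
  shows "(\<integral>\<omega>. f (U \<omega>) \<partial>M) = integral {0..1} f"
proof -
  have fm [measurable]: "f \<in> borel_measurable borel" using f by (rule borel_measurable_continuous_onI)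
  have "(\<integral>\<omega>. f (U \<omega>) \<partial>M) = (\<integral>x. f x \<partial>uniform_measure lborel {0..1})"
    unfolding D[symmetric] using U fm by (intro integral_distr[symmetric]) auto
  also have "uniform_measure lborel {0..1} = density lborel (\<lambda>x. ennreal (indicator {0..1::real} x))"
    by (simp add: uniform_measure_def divide_ennreal_def flip: ennreal_indicator)
  also have "(\<integral>x. f x \<partial>density lborel (\<lambda>x. ennreal (indicator {0..1::real} x)))
      = (\<integral>x. indicator {0..1} x *\<^sub>R f x \<partial>lborel)"
    by (intro integral_density) auto
  also have "\<dots> = integral {0..1} f"
  proof -
    have "set_integrable lborel {0..1} f"
      using f by (intro borel_integrable_atLeastAtMost') (blast intro: continuous_on_subset)
    from set_borel_integral_eq_integral(2)[OF this] show ?thesis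
      by (simp add: set_lebesgue_integral_def)
  qed
  finally show ?thesis .
qed

section \<open>Birkhoff sums on the circle and their moment generating functions\<close>

abbreviation S0 :: "nat \<Rightarrow> nat \<Rightarrow> real \<Rightarrow> real" where
  "S0 \<equiv> S (\<lambda>x. x)"

lemma continuous_on_S0 [continuous_intros]:
  fixes f :: "real \<Rightarrow> real"
  shows "continuous_on A f \<Longrightarrow> continuous_on A (\<lambda>x. S0 q n (f x))"
  unfolding S_def by (auto intro!: continuous_intros)

lemma S0_periodic: "S0 q n (x + 1) = S0 q n x"
proof -
  have "cos (2 * pi * real q ^ k * (x + 1)) = cos (2 * pi * real q ^ k * x)" for k
    using cos_add_2pi_of_nat[of "2 * pi * real q ^ k * x" "q ^ k"] by (simp add: algebra_simps)
  then show ?thesis by (simp add: S_def)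
qed

text \<open>The cocycle identity of Birkhoff sums for the map that multiplies by
  \<open>q\<close>.\<close>

lemma S0_add: "S0 q (m + n) x = S0 q m x + S0 q n (real (q ^ m) * x)"
proof -
  have "(\<Sum>k=1..m + n. cos (2 * pi * real q ^ k * x)) =
      (\<Sum>k=1..m. cos (2 * pi * real q ^ k * x)) + (\<Sum>k=m+1..m+n. cos (2 * pi * real q ^ k * x))"
    by (rule sum.ub_add_nat) simp
  also have "(\<Sum>k=m+1..m+n. cos (2 * pi * real q ^ k * x)) = (\<Sum>k=1..n. cos (2 * pi * real q ^ (k + m) * x))"
    using sum.shift_bounds_cl_nat_ivl[of "\<lambda>k. cos (2 * pi * real q ^ k * x)" 1 m n] by (simp add: add.commute)
  finally show ?thesis by (simp add: S_def power_add mult_ac)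
qed

lemma S0_Suc: "S0 q (Suc n) x = cos (2 * pi * (real q * x)) + S0 q n (real q * x)"
  using S0_add[of q 1 n x] by (simp add: S_def mult.assoc)

lemma abs_S0_le: "\<bar>S0 q n x\<bar> \<le> real n"
proof -
  have "\<bar>S0 q n x\<bar> \<le> (\<Sum>k=1..n. 1)"
    unfolding S_def by (rule order_trans[OF sum_abs]) (intro sum_mono abs_cos_le_one)
  then show ?thesis by simp
qed

lemma abs_cos_diff_le: "\<bar>cos x - cos y\<bar> \<le> \<bar>x - y\<bar>" for x y :: real
proof -
  have "\<bar>cos x - cos y\<bar> = 2 * \<bar>sin ((x + y) / 2)\<bar> * \<bar>sin ((y - x) / 2)\<bar>"
    by (simp add: cos_diff_cos abs_mult)
  also have "\<dots> \<le> 2 * 1 * \<bar>(y - x) / 2\<bar>"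
    by (intro mult_mono abs_sin_x_le_abs_x) auto
  finally show ?thesis by simp
qed

text \<open>Bounded distortion: the inverse branch contracts by \<open>q ^ m\<close>, so the summand
  with index k moves by at most 2 pi q^(k - m), and these bounds sum to at most 4 pi, independently
  of \<open>m\<close>.\<close>

lemma S0_distortion:
  assumes q: "2 \<le> q" and xy: "\<bar>x - y\<bar> \<le> 1"
  shows "\<bar>S0 q m ((x + j) / real (q ^ m)) - S0 q m ((y + j) / real (q ^ m))\<bar> \<le> 4 * pi"
proof -
  have geo: "(\<Sum>k=1..m. real q ^ k) \<le> 2 * real q ^ m" for m
  proof (induction m)
    case (Suc m)
    have "2 * real q ^ m \<le> real q * real q ^ m" using q by (intro mult_right_mono) auto
    then show ?case using Suc by simp
  qed simp
  have "\<bar>S0 q m ((x + j) / real (q ^ m)) - S0 q m ((y + j) / real (q ^ m))\<bar>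
      \<le> (\<Sum>k=1..m. 2 * pi * real q ^ k / real q ^ m)"
    unfolding S_def sum_subtractf[symmetric]
  proof (rule order_trans[OF sum_abs], rule sum_mono)
    fix k
    have "\<bar>cos (2 * pi * real q ^ k * ((x + j) / real (q ^ m))) - cos (2 * pi * real q ^ k * ((y + j) / real (q ^ m)))\<bar>
       \<le> \<bar>2 * pi * real q ^ k * ((x + j) / real (q ^ m)) - 2 * pi * real q ^ k * ((y + j) / real (q ^ m))\<bar>"
      by (rule abs_cos_diff_le)
    also have "\<dots> = \<bar>2 * pi * real q ^ k / real q ^ m * (x - y)\<bar>"
      by (rule arg_cong[of _ _ abs]) (use q in \<open>simp add: field_simps\<close>)
    also have "\<dots> = 2 * pi * real q ^ k / real q ^ m * \<bar>x - y\<bar>"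
      by (simp add: abs_mult)
    also have "\<dots> \<le> 2 * pi * real q ^ k / real q ^ m * 1"
      using xy by (intro mult_left_mono) auto
    finally show "\<bar>cos (2 * pi * real q ^ k * ((x + j) / real (q ^ m))) - cos (2 * pi * real q ^ k * ((y + j) / real (q ^ m)))\<bar>
      \<le> 2 * pi * real q ^ k / real q ^ m" by simp
  qed
  also have "\<dots> = 2 * pi * (\<Sum>k=1..m. real q ^ k) / real q ^ m"
    by (simp add: sum_distrib_left sum_divide_distrib)
  also have "\<dots> \<le> 2 * pi * (2 * real q ^ m) / real q ^ m"
    using geo by (intro divide_right_mono mult_left_mono) auto
  also have "\<dots> = 4 * pi" using q by simp
  finally show ?thesis .
qed

definition mgf :: "nat \<Rightarrow> nat \<Rightarrow> real \<Rightarrow> real" where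
  "mgf q n \<theta> = integral {0..1} (\<lambda>x. exp (\<theta> * S0 q n x))"

lemma integral_mono_01:
  fixes f g :: "real \<Rightarrow> real"
  assumes "continuous_on {0..1} f" "continuous_on {0..1} g" "\<And>x. x \<in> {0..1} \<Longrightarrow> f x \<le> g x"
  shows "integral {0..1} f \<le> integral {0..1} g"
  using assms by (intro integral_le integrable_continuous_real) auto

lemma exp_theta_S0_lower: "exp (- (\<bar>\<theta>\<bar> * real n)) \<le> exp (\<theta> * S0 q n x)"
proof -
  have "\<bar>\<theta> * S0 q n x\<bar> \<le> \<bar>\<theta>\<bar> * real n"
    unfolding abs_mult by (intro mult_left_mono abs_S0_le) auto
  then show ?thesis by auto
qed

lemma mgf_lower: "exp (- (\<bar>\<theta>\<bar> * real n)) \<le> mgf q n \<theta>"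
proof -
  have "integral {0..1::real} (\<lambda>x. exp (- (\<bar>\<theta>\<bar> * real n))) \<le> mgf q n \<theta>"
    unfolding mgf_def by (intro integral_mono_01 continuous_intros exp_theta_S0_lower)
  then show ?thesis by simp
qed

lemma mgf_pos: "0 < mgf q n \<theta>"
  by (rule less_le_trans[OF exp_gt_zero mgf_lower])

lemma continuous_on_mean_op:
  assumes "continuous_on UNIV f" and q: "0 < q"
  shows "continuous_on A (mean_op q f)"
  unfolding mean_op_def using q
  by (intro continuous_intros continuous_on_compose2[OF assms(1)]) auto

text \<open>\<open>S0 q m\<close> varies by at most \<open>4\<pi>\<close> on an interval of length \<open>q\<^sup>-\<^sup>m\<close>, while \<open>S0 q n (q\<^sup>m x)\<close> runs
  through a full period there.\<close>

lemma mgf_submult: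
  assumes q: "2 \<le> q"
  shows "mgf q (m + n) \<theta> \<le> exp (4 * pi * \<bar>\<theta>\<bar>) * mgf q m \<theta> * mgf q n \<theta>"
proof -
  define K where "K = exp (4 * pi * \<bar>\<theta>\<bar>)"
  define f where "f = (\<lambda>x. exp (\<theta> * S0 q m x))"
  define g where "g = (\<lambda>x. exp (\<theta> * S0 q n x))"
  have fc: "continuous_on UNIV f" and gc: "continuous_on A g" for A
    unfolding f_def g_def by (intro continuous_intros)+
  have Q: "0 < q ^ m" using q by simp
  have mc: "continuous_on A (mean_op (q ^ m) f)" for A by (rule continuous_on_mean_op[OF fc Q])
  \<comment> \<open>Distortion makes the averaged function constant up to the factor
    \<open>K\<close>; integrating over \<open>y\<close> then bounds it pointwise by
    \<open>K * mgf q m \<theta>\<close>.\<close>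
  have "mean_op (q ^ m) f x \<le> K * mean_op (q ^ m) f y" if "x \<in> {0..1}" "y \<in> {0..1}" for x y
  proof -
    have "f ((x + real j) / real (q ^ m)) \<le> K * f ((y + real j) / real (q ^ m))" for j
    proof -
      let ?a = "S0 q m ((x + real j) / real (q ^ m))" and ?b = "S0 q m ((y + real j) / real (q ^ m))"
      have "\<theta> * (?a - ?b) \<le> \<bar>\<theta>\<bar> * \<bar>?a - ?b\<bar>" by (metis abs_ge_self abs_mult)
      also have "\<dots> \<le> \<bar>\<theta>\<bar> * (4 * pi)" using that q by (intro mult_left_mono S0_distortion) auto
      finally have "\<theta> * ?a \<le> 4 * pi * \<bar>\<theta>\<bar> + \<theta> * ?b" by (simp add: algebra_simps)
      then show ?thesis unfolding f_def K_def exp_add[symmetric] by simp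
    qed
    then have "(\<Sum>j<q ^ m. f ((x + real j) / real (q ^ m))) \<le> K * (\<Sum>j<q ^ m. f ((y + real j) / real (q ^ m)))"
      unfolding sum_distrib_left by (intro sum_mono)
    then show ?thesis unfolding mean_op_def by (simp add: divide_right_mono del: of_nat_power)
  qed
  then have "integral {0..1::real} (\<lambda>y. mean_op (q ^ m) f x) \<le> integral {0..1} (\<lambda>y. K * mean_op (q ^ m) f y)"
    if "x \<in> {0..1}" for x
    using that by (intro integral_mono_01 continuous_intros mc) auto
  moreover have "integral {0..1} (mean_op (q ^ m) f) = mgf q m \<theta>"
    using integral_mult_periodic[OF Q fc, of "\<lambda>_. 1"] by (simp add: f_def mgf_def)
  ultimately have le: "mean_op (q ^ m) f x \<le> K * mgf q m \<theta>" if "x \<in> {0..1}" for x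
    using that by simp
  have "mgf q (m + n) \<theta> = integral {0..1} (\<lambda>x. f x * g (real (q ^ m) * x))"
    by (simp add: mgf_def f_def g_def S0_add exp_add distrib_left)
  also have "\<dots> = integral {0..1} (\<lambda>x. mean_op (q ^ m) f x * g x)"
    by (rule integral_mult_periodic[OF Q fc gc]) (simp add: g_def S0_periodic)
  also have "\<dots> \<le> integral {0..1} (\<lambda>x. (K * mgf q m \<theta>) * g x)"
    using le by (intro integral_mono_01 continuous_intros mc gc mult_right_mono) (auto simp: g_def)
  also have "\<dots> = K * mgf q m \<theta> * mgf q n \<theta>" by (simp add: g_def mgf_def)
  finally show ?thesis by (simp add: K_def)
qed

text \<open>Adding the constant \<open>c\<close> to the logarithm absorbs the factor in
  \<open>mgf_submult\<close> and gives a truly subadditive sequence; \<open>c / real n\<close>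
  disappears in the limit.\<close>

lemma convergent_ln_mgf:
  assumes q: "2 \<le> q"
  shows "convergent (\<lambda>n. ln (mgf q n \<theta>) / real n)"
proof -
  define c where "c = 4 * pi * \<bar>\<theta>\<bar>"
  define u where "u n = ln (mgf q n \<theta>) + c" for n
  have "convergent (\<lambda>n. u n / real n)"
  proof (rule fekete)
    fix m n
    have "ln (mgf q (m + n) \<theta>) \<le> ln (exp c * mgf q m \<theta> * mgf q n \<theta>)"
      using mgf_submult[OF q] mgf_pos by (intro ln_mono) (auto simp: c_def)
    also have "\<dots> = c + ln (mgf q m \<theta>) + ln (mgf q n \<theta>)"
      using mgf_pos by (simp add: ln_mult_pos)
    finally show "u (m + n) \<le> u m + u n" by (simp add: u_def)
  next
    fix n
    have "- (\<bar>\<theta>\<bar> * real n) \<le> ln (mgf q n \<theta>)"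
      using mgf_lower mgf_pos by (subst ln_ge_iff) auto
    moreover have "0 \<le> c" by (simp add: c_def)
    ultimately show "- (\<bar>\<theta>\<bar> * real n) \<le> u n" unfolding u_def by linarith
  qed
  moreover have "(\<lambda>n. c / real n) \<longlonglongrightarrow> 0" by (rule lim_const_over_n)
  ultimately have "convergent (\<lambda>n. u n / real n - c / real n)"
    by (intro convergent_diff) (auto intro: convergentI)
  then show ?thesis by (simp add: u_def add_divide_distrib)
qed

subsection \<open>Approximate eigenfunctions\<close>

text \<open>For \<open>vs = [w\<^sub>k, ..., w\<^sub>0]\<close>, \<open>exp_times 1 vs\<close> is the Horner form of
  \<open>\<Sum>\<^sub>j cos\<^sup>j w\<^sub>k\<^sub>-\<^sub>j / j!\<close>, the coefficient of \<open>\<theta>\<^sup>k\<close> in \<open>exp (\<theta> cos) \<Sum>\<^sub>i \<theta>\<^sup>i w\<^sub>i\<close>.\<close>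

fun exp_times :: "nat \<Rightarrow> real list list \<Rightarrow> real list" where
  "exp_times m [] = []"
| "exp_times m (v # vs) = list_plus v (map ((*) (1 / real m)) (times_cos (exp_times (Suc m) vs)))"

text \<open>With \<open>vs\<close> reversed as for \<open>exp_times\<close>, this is the Cauchy
  product coefficient of \<theta>^k in the eigenvalue times the eigenfunction.\<close>

fun lin_comb :: "real list \<Rightarrow> real list list \<Rightarrow> real list" where
  "lin_comb (l # ls) (v # vs) = list_plus (map ((*) l) v) (lin_comb ls vs)"
| "lin_comb _ _ = []"

text \<open>The Horner recursion changes its divisor, so the induction needs a general start
  \<open>Suc m\<close>; at \<open>m = 0\<close> the factor becomes the exponential coefficient
  \<open>1 / fact j\<close>.\<close>

lemma cos_series_exp_times:
  "cos_series 0 (exp_times (Suc m) vs) x =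
    (\<Sum>j<length vs. cos (2 * pi * x) ^ j * (fact m / fact (m + j)) * cos_series 0 (vs ! j) x)"
proof (induction vs arbitrary: m)
  case (Cons v vs)
  have "cos (2 * pi * x) ^ Suc j * (fact m / fact (m + Suc j)) * c =
      1 / real (Suc m) * cos (2 * pi * x) * (cos (2 * pi * x) ^ j * (fact (Suc m) / fact (Suc m + j)) * c)" for j c
    by (simp add: field_simps del: of_nat_Suc)
  then show ?case
    by (simp add: sum.lessThan_Suc_shift cos_series_list_plus cos_series_scale cos_series_times_cos
        Cons.IH sum_distrib_left mult.assoc del: sum.lessThan_Suc of_nat_Suc)
qed simp

lemma cos_series_lin_comb:
  "length vs \<le> length ls \<Longrightarrow>
    cos_series 0 (lin_comb ls vs) x = (\<Sum>j<length vs. ls ! j * cos_series 0 (vs ! j) x)"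
  by (induction ls vs rule: lin_comb.induct)
    (auto simp: sum.lessThan_Suc_shift cos_series_list_plus cos_series_scale simp del: sum.lessThan_Suc)

lemma cos_series_zeros: "list_all (\<lambda>a. a = 0) as \<Longrightarrow> cos_series k as x = 0"
  by (induction as arbitrary: k) auto

text \<open>The eigenvalue equation \<open>mean_op q (exp (\<theta> cos) w) = \<lambda> w\<close> at order \<open>\<theta>\<^sup>k\<close>, where
  \<open>ls\<close> and \<open>ws\<close> list the coefficients of \<open>\<lambda>\<close> and \<open>w\<close>.\<close>

definition eigen_coeff :: "nat \<Rightarrow> real list \<Rightarrow> real list list \<Rightarrow> nat \<Rightarrow> bool" where
  "eigen_coeff q ls ws k \<longleftrightarrow> (let vs = rev (take (Suc k) ws) in
     list_all (\<lambda>a. a = 0)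
       (list_plus (decimate q 0 (exp_times 1 vs)) (map ((*) (-1)) (lin_comb ls vs))))"

lemma eigen_coeff_imp:
  assumes q: "0 < q" and e: "eigen_coeff q ls ws k" and k: "k < length ws" "k < length ls"
  shows "mean_op q (\<lambda>x. \<Sum>j\<le>k. cos (2 * pi * x) ^ j / fact j * cos_series 0 (ws ! (k - j)) x) x =
    (\<Sum>j\<le>k. ls ! j * cos_series 0 (ws ! (k - j)) x)"
proof -
  define vs where "vs = rev (take (Suc k) ws)"
  have len: "length vs = Suc k" using k by (simp add: vs_def)
  have nth: "vs ! j = ws ! (k - j)" if "j \<le> k" for j
    using that k by (simp add: vs_def rev_nth)
  have 1: "cos_series 0 (exp_times 1 vs) x = (\<Sum>j\<le>k. cos (2 * pi * x) ^ j / fact j * cos_series 0 (ws ! (k - j)) x)" for x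
    using cos_series_exp_times[of 0 vs x] by (simp add: len nth lessThan_Suc_atMost)
  have 2: "cos_series 0 (lin_comb ls vs) x = (\<Sum>j\<le>k. ls ! j * cos_series 0 (ws ! (k - j)) x)"
    using cos_series_lin_comb[of vs ls x] k by (simp add: len nth lessThan_Suc_atMost)
  have "cos_series 0 (list_plus (decimate q 0 (exp_times 1 vs)) (map ((*) (-1)) (lin_comb ls vs))) x = 0"
    using e by (intro cos_series_zeros) (simp add: eigen_coeff_def vs_def Let_def)
  then have "cos_series 0 (decimate q 0 (exp_times 1 vs)) x = cos_series 0 (lin_comb ls vs) x"
    by (simp only: cos_series_list_plus cos_series_scale)
  moreover have "mean_op q (cos_series 0 (exp_times 1 vs)) x = cos_series 0 (decimate q 0 (exp_times 1 vs)) x"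
    using mean_op_cos_series[OF q, where k = 0 and n = 0 and as = "exp_times 1 vs" and x = x] q by simp
  ultimately show ?thesis by (simp only: 1[abs_def] 2)
qed

text \<open>The full product differs from the truncated Cauchy product only in terms with
  \<open>i + j \<ge> N\<close>, of which there are at most the square of \<open>N\<close>.\<close>

lemma truncated_product_error:
  fixes a b :: "nat \<Rightarrow> real"
  assumes a: "\<And>j. j < N \<Longrightarrow> \<bar>a j\<bar> \<le> A" and b: "\<And>i. i < N \<Longrightarrow> \<bar>b i\<bar> \<le> B"
    and \<theta>: "\<bar>\<theta>\<bar> \<le> 1" and AB: "0 \<le> A" "0 \<le> B"
  shows "\<bar>(\<Sum>j<N. \<theta> ^ j * a j) * (\<Sum>i<N. \<theta> ^ i * b i) - (\<Sum>k<N. \<theta> ^ k * (\<Sum>j\<le>k. a j * b (k - j)))\<bar>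
    \<le> real N ^ 2 * (A * B) * \<bar>\<theta>\<bar> ^ N"
proof -
  let ?g = "\<lambda>(i, j). \<theta> ^ (i + j) * (a i * b j)"
  let ?T = "{(i, j). i + j < N}"
  have sub: "?T \<subseteq> {..<N} \<times> {..<N}" by auto
  have "(\<Sum>j<N. \<theta> ^ j * a j) * (\<Sum>i<N. \<theta> ^ i * b i) = sum ?g ({..<N} \<times> {..<N})"
    by (simp add: sum_product sum.cartesian_product power_add mult_ac)
  moreover have "(\<Sum>k<N. \<theta> ^ k * (\<Sum>j\<le>k. a j * b (k - j))) = sum ?g ?T"
    using sum.triangle_reindex[of "\<lambda>i j. \<theta> ^ (i + j) * (a i * b j)" N] by (simp add: sum_distrib_left)
  ultimately have "(\<Sum>j<N. \<theta> ^ j * a j) * (\<Sum>i<N. \<theta> ^ i * b i) - (\<Sum>k<N. \<theta> ^ k * (\<Sum>j\<le>k. a j * b (k - j)))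
      = sum ?g ({..<N} \<times> {..<N} - ?T)"
    using sub by (simp add: sum_diff)
  also have "\<bar>\<dots>\<bar> \<le> (\<Sum>p\<in>{..<N} \<times> {..<N} - ?T. \<bar>\<theta>\<bar> ^ N * (A * B))"
  proof (rule order_trans[OF sum_abs], rule sum_mono)
    fix p assume "p \<in> {..<N} \<times> {..<N} - ?T"
    then obtain i j where p: "p = (i, j)" and ij: "i < N" "j < N" "N \<le> i + j" by auto
    have "\<bar>\<theta>\<bar> ^ (i + j) \<le> \<bar>\<theta>\<bar> ^ N" using ij \<theta> by (intro power_decreasing) auto
    moreover have "\<bar>a i\<bar> * \<bar>b j\<bar> \<le> A * B" using ij a b AB by (intro mult_mono) auto
    ultimately have "\<bar>\<theta> ^ (i + j) * (a i * b j)\<bar> \<le> \<bar>\<theta>\<bar> ^ N * (A * B)"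
      unfolding abs_mult power_abs by (rule mult_mono) (use AB in auto)
    then show "\<bar>?g p\<bar> \<le> \<bar>\<theta>\<bar> ^ N * (A * B)" by (simp add: p)
  qed
  also have "\<dots> \<le> (\<Sum>p\<in>{..<N} \<times> {..<N}. \<bar>\<theta>\<bar> ^ N * (A * B))"
    using AB by (intro sum_mono2) auto
  also have "\<dots> = real N ^ 2 * (A * B) * \<bar>\<theta>\<bar> ^ N"
    by (simp add: card_cartesian_product power2_eq_square)
  finally show ?thesis .
qed

lemma exp_truncation_error:
  fixes y :: real
  assumes "\<bar>y\<bar> \<le> 1"
  shows "\<bar>exp y - (\<Sum>m<N. y ^ m / fact m)\<bar> \<le> exp 1 * \<bar>y\<bar> ^ N"
proof -
  obtain t where t: "\<bar>t\<bar> \<le> \<bar>y\<bar>" "exp y = (\<Sum>m<N. y ^ m / fact m) + exp t / fact N * y ^ N"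
    using Maclaurin_exp_le by blast
  have "\<bar>exp t / fact N * y ^ N\<bar> = exp t / fact N * \<bar>y\<bar> ^ N" by (simp add: abs_mult power_abs)
  also have "\<dots> \<le> exp 1 / 1 * \<bar>y\<bar> ^ N"
    using t assms by (intro mult_right_mono frac_le) auto
  finally show ?thesis using t by simp
qed

text \<open>By \<open>eq\<close> the coefficients below order \<open>N\<close> of both sides agree,
  so only truncation errors remain, and these are uniform in \<open>x\<close>.\<close>

lemma eigen_residual_bound:
  fixes f :: "nat \<Rightarrow> real \<Rightarrow> real" and l :: "nat \<Rightarrow> real"
  assumes q: "0 < q"
    and f: "\<And>k x. k < N \<Longrightarrow> \<bar>f k x\<bar> \<le> B"
    and eq: "\<And>k x. k < N \<Longrightarrow> mean_op q (\<lambda>x. \<Sum>j\<le>k. cos (2 * pi * x) ^ j / fact j * f (k - j) x) x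
        = (\<Sum>j\<le>k. l j * f (k - j) x)"
  shows "\<exists>C\<ge>0. \<forall>\<theta> x. \<bar>\<theta>\<bar> \<le> 1 \<longrightarrow>
     \<bar>mean_op q (\<lambda>x. exp (\<theta> * cos (2 * pi * x)) * (\<Sum>k<N. \<theta> ^ k * f k x)) x
       - (\<Sum>k<N. \<theta> ^ k * l k) * (\<Sum>k<N. \<theta> ^ k * f k x)\<bar> \<le> C * \<bar>\<theta>\<bar> ^ N"
proof -
  \<comment> \<open>For \<open>N = 0\<close> the bound on \<open>f\<close> is vacuous and
    \<open>B\<close> may be negative.\<close>
  define B' where "B' = max 0 B"
  have B': "0 \<le> B'" "\<And>k x. k < N \<Longrightarrow> \<bar>f k x\<bar> \<le> B'"
    using f by (auto simp: B'_def le_max_iff_disj)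
  define A where "A = (\<Sum>k<N. \<bar>l k\<bar>)"
  have A: "0 \<le> A" "\<And>k. k < N \<Longrightarrow> \<bar>l k\<bar> \<le> A"
    unfolding A_def by (auto intro!: sum_nonneg member_le_sum)
  \<comment> \<open>The tail of the exponential series times the size of w, then the two truncated
    products: exponential times w, and eigenvalue times w.\<close>
  define C where "C = exp 1 * (real N * B') + real N ^ 2 * (1 * B') + real N ^ 2 * (A * B')"
  show ?thesis
  proof (intro exI[of _ C] conjI allI impI)
    show "0 \<le> C" unfolding C_def using A(1) B'(1) by simp
    fix \<theta> x :: real assume \<theta>: "\<bar>\<theta>\<bar> \<le> 1"
    define w where "w x = (\<Sum>k<N. \<theta> ^ k * f k x)" for x
    define E where "E k x = (\<Sum>j\<le>k. cos (2 * pi * x) ^ j / fact j * f (k - j) x)" for k x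
    have w: "\<bar>w x\<bar> \<le> real N * B'" for x
    proof -
      have "\<bar>\<theta> ^ k * f k x\<bar> \<le> 1 * B'" if "k < N" for k
        unfolding abs_mult power_abs by (intro mult_mono power_le_one) (use \<theta> B' that in auto)
      then have "\<bar>w x\<bar> \<le> (\<Sum>k<N. 1 * B')"
        unfolding w_def by (intro order_trans[OF sum_abs] sum_mono) auto
      then show ?thesis by simp
    qed
    have pt: "\<bar>exp (\<theta> * cos (2 * pi * x)) * w x - (\<Sum>k<N. \<theta> ^ k * E k x)\<bar>
        \<le> (exp 1 * (real N * B') + real N ^ 2 * (1 * B')) * \<bar>\<theta>\<bar> ^ N" for x
    proof -
      define c where "c = cos (2 * pi * x)"
      have c: "\<bar>c\<bar> \<le> 1" by (simp add: c_def)
      have tc: "\<bar>\<theta> * c\<bar> \<le> \<bar>\<theta>\<bar>" using c by (simp add: abs_mult mult_left_le)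
      have "\<bar>exp (\<theta> * c) - (\<Sum>m<N. (\<theta> * c) ^ m / fact m)\<bar> \<le> exp 1 * \<bar>\<theta> * c\<bar> ^ N"
        using tc \<theta> by (intro exp_truncation_error) auto
      also have "\<dots> \<le> exp 1 * \<bar>\<theta>\<bar> ^ N" using tc by (intro mult_left_mono power_mono) auto
      finally have "\<bar>exp (\<theta> * c) - (\<Sum>m<N. \<theta> ^ m * (c ^ m / fact m))\<bar> \<le> exp 1 * \<bar>\<theta>\<bar> ^ N"
        by (simp add: power_mult_distrib)
      then have "\<bar>(exp (\<theta> * c) - (\<Sum>m<N. \<theta> ^ m * (c ^ m / fact m))) * w x\<bar> \<le> (exp 1 * \<bar>\<theta>\<bar> ^ N) * (real N * B')"
        unfolding abs_mult by (intro mult_mono w) auto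
      moreover have "\<bar>(\<Sum>m<N. \<theta> ^ m * (c ^ m / fact m)) * w x - (\<Sum>k<N. \<theta> ^ k * E k x)\<bar> \<le> real N ^ 2 * (1 * B') * \<bar>\<theta>\<bar> ^ N"
        unfolding w_def E_def c_def[symmetric]
      proof (rule truncated_product_error)
        show "\<bar>c ^ j / fact j\<bar> \<le> 1" for j
        proof -
          have "\<bar>c\<bar> ^ j / fact j \<le> 1 / 1" using c by (intro frac_le power_le_one) auto
          then show ?thesis by (simp add: power_abs)
        qed
      qed (use \<theta> B' in auto)
      ultimately show ?thesis unfolding c_def by (simp add: algebra_simps)
    qed
    have "mean_op q (\<lambda>x. \<Sum>k<N. \<theta> ^ k * E k x) x = (\<Sum>k<N. \<theta> ^ k * (\<Sum>j\<le>k. l j * f (k - j) x))"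
      unfolding mean_op_sum mean_op_cmult using eq by (simp add: E_def[abs_def])
    moreover have "\<bar>(\<Sum>k<N. \<theta> ^ k * l k) * w x - (\<Sum>k<N. \<theta> ^ k * (\<Sum>j\<le>k. l j * f (k - j) x))\<bar>
        \<le> real N ^ 2 * (A * B') * \<bar>\<theta>\<bar> ^ N"
      unfolding w_def by (rule truncated_product_error) (use \<theta> A B' in auto)
    moreover have "\<bar>mean_op q (\<lambda>x. exp (\<theta> * cos (2 * pi * x)) * w x) x - mean_op q (\<lambda>x. \<Sum>k<N. \<theta> ^ k * E k x) x\<bar>
        \<le> (exp 1 * (real N * B') + real N ^ 2 * (1 * B')) * \<bar>\<theta>\<bar> ^ N"
      by (rule mean_op_abs_diff_le[OF q]) (rule pt)
    moreover have "C * \<bar>\<theta>\<bar> ^ N = (exp 1 * (real N * B') + real N ^ 2 * (1 * B')) * \<bar>\<theta>\<bar> ^ N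
        + real N ^ 2 * (A * B') * \<bar>\<theta>\<bar> ^ N"
      by (simp add: C_def algebra_simps)
    ultimately show "\<bar>mean_op q (\<lambda>x. exp (\<theta> * cos (2 * pi * x)) * (\<Sum>k<N. \<theta> ^ k * f k x)) x
       - (\<Sum>k<N. \<theta> ^ k * l k) * (\<Sum>k<N. \<theta> ^ k * f k x)\<bar> \<le> C * \<bar>\<theta>\<bar> ^ N"
      unfolding w_def[symmetric] by linarith
  qed
qed

text \<open>The weighted integral \<open>A n\<close> is comparable to
  \<open>mgf q n \<theta>\<close> with constants free of \<open>n\<close>, and adjointness makes
  each step from \<open>A n\<close> to \<open>A (Suc n)\<close> multiply by a factor between
  \<open>lo\<close> and \<open>hi\<close>.\<close>

lemma mgf_growth:
  assumes q: "2 \<le> q" and wc: "continuous_on UNIV w"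
    and w: "\<And>x. 1/2 \<le> w x" "\<And>x. w x \<le> 2" and lo: "0 < lo"
    and le: "\<And>x. lo * w x \<le> mean_op q (\<lambda>x. exp (\<theta> * cos (2 * pi * x)) * w x) x"
      "\<And>x. mean_op q (\<lambda>x. exp (\<theta> * cos (2 * pi * x)) * w x) x \<le> hi * w x"
  shows "exp (- \<bar>\<theta>\<bar>) ^ 2 / 4 * lo ^ n \<le> mgf q n \<theta>"
    and "mgf q n \<theta> \<le> 4 * exp \<bar>\<theta>\<bar> ^ 2 * hi ^ n"
proof -
  \<comment> \<open>The sum \<open>S0\<close> starts at index 1. The extra exponential restores the
    term of index 0, so that the recursion reproduces the operator applied to
    \<open>w\<close>.\<close>
  define A where "A n = integral {0..1} (\<lambda>x. exp (\<theta> * cos (2 * pi * x)) * w x * exp (\<theta> * S0 q n x))" for n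
  have wc': "continuous_on X w" for X using wc by (rule continuous_on_subset) simp
  have w0: "0 < w 0" using w(1)[of 0] by simp
  then have "0 < lo * w 0" using lo by simp
  also have "\<dots> \<le> hi * w 0" using le[of 0] by (rule order_trans)
  finally have hi: "0 < hi" using w0 by (simp add: zero_less_mult_iff)
  have mean_c: "continuous_on X (mean_op q (\<lambda>x. exp (\<theta> * cos (2 * pi * x)) * w x))" for X
    using q by (intro continuous_on_mean_op continuous_intros wc) auto
  have A_Suc: "A (Suc n) = integral {0..1} (\<lambda>x. mean_op q (\<lambda>x. exp (\<theta> * cos (2 * pi * x)) * w x) x
       * (exp (\<theta> * cos (2 * pi * x)) * exp (\<theta> * S0 q n x)))" for n
  proof -
    have "A (Suc n) = integral {0..1} (\<lambda>x. (exp (\<theta> * cos (2 * pi * x)) * w x) *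
        (\<lambda>y. exp (\<theta> * cos (2 * pi * y)) * exp (\<theta> * S0 q n y)) (real q * x))"
      unfolding A_def S0_Suc distrib_left exp_add by (rule refl)
    also have "\<dots> = integral {0..1} (\<lambda>x. mean_op q (\<lambda>x. exp (\<theta> * cos (2 * pi * x)) * w x) x
       * (exp (\<theta> * cos (2 * pi * x)) * exp (\<theta> * S0 q n x)))"
    proof (rule integral_mult_periodic)
      fix x
      have "cos (2 * pi * (x + 1)) = cos (2 * pi * x)"
        using cos_add_2pi_of_nat[of "2 * pi * x" 1] by (simp add: distrib_left)
      then show "exp (\<theta> * cos (2 * pi * (x + 1))) * exp (\<theta> * S0 q n (x + 1)) =
         exp (\<theta> * cos (2 * pi * x)) * exp (\<theta> * S0 q n x)" by (simp add: S0_periodic)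
    qed (use q in \<open>auto intro!: continuous_intros wc'\<close>)
    finally show ?thesis .
  qed
  have A_lo: "lo * A n \<le> A (Suc n)" for n
  proof -
    have "integral {0..1} (\<lambda>x. lo * w x * (exp (\<theta> * cos (2 * pi * x)) * exp (\<theta> * S0 q n x))) \<le> A (Suc n)"
      unfolding A_Suc by (intro integral_mono_01 continuous_intros wc' mean_c mult_right_mono le) auto
    also have "integral {0..1} (\<lambda>x. lo * w x * (exp (\<theta> * cos (2 * pi * x)) * exp (\<theta> * S0 q n x))) = lo * A n"
      unfolding A_def integral_mult_right[symmetric] by (rule integral_cong) simp
    finally show ?thesis .
  qed
  have A_hi: "A (Suc n) \<le> hi * A n" for n
  proof -
    have "A (Suc n) \<le> integral {0..1} (\<lambda>x. hi * w x * (exp (\<theta> * cos (2 * pi * x)) * exp (\<theta> * S0 q n x)))"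
      unfolding A_Suc by (intro integral_mono_01 continuous_intros wc' mean_c mult_right_mono le) auto
    also have "integral {0..1} (\<lambda>x. hi * w x * (exp (\<theta> * cos (2 * pi * x)) * exp (\<theta> * S0 q n x))) = hi * A n"
      unfolding A_def integral_mult_right[symmetric] by (rule integral_cong) simp
    finally show ?thesis .
  qed
  have ew: "exp (- \<bar>\<theta>\<bar>) / 2 \<le> exp (\<theta> * cos (2 * pi * x)) * w x"
    "exp (\<theta> * cos (2 * pi * x)) * w x \<le> 2 * exp \<bar>\<theta>\<bar>" for x
  proof -
    have "\<bar>\<theta> * cos (2 * pi * x)\<bar> \<le> \<bar>\<theta>\<bar>" by (simp add: abs_mult mult_left_le)
    then have b: "- \<bar>\<theta>\<bar> \<le> \<theta> * cos (2 * pi * x)" "\<theta> * cos (2 * pi * x) \<le> \<bar>\<theta>\<bar>" by linarith+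
    have "exp (- \<bar>\<theta>\<bar>) * (1/2) \<le> exp (\<theta> * cos (2 * pi * x)) * w x"
      using b w by (intro mult_mono) auto
    then show "exp (- \<bar>\<theta>\<bar>) / 2 \<le> exp (\<theta> * cos (2 * pi * x)) * w x" by simp
    have "exp (\<theta> * cos (2 * pi * x)) * w x \<le> exp \<bar>\<theta>\<bar> * 2"
      using b w w(1)[of x] by (intro mult_mono order_trans[OF _ w(1)[of x]]) auto
    then show "exp (\<theta> * cos (2 * pi * x)) * w x \<le> 2 * exp \<bar>\<theta>\<bar>" by simp
  qed
  have A_mgf: "exp (- \<bar>\<theta>\<bar>) / 2 * mgf q n \<theta> \<le> A n" "A n \<le> 2 * exp \<bar>\<theta>\<bar> * mgf q n \<theta>" for n
  proof -
    have "integral {0..1} (\<lambda>x. exp (- \<bar>\<theta>\<bar>) / 2 * exp (\<theta> * S0 q n x)) \<le> A n"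
      unfolding A_def by (intro integral_mono_01 continuous_intros wc' mult_right_mono ew) auto
    then show "exp (- \<bar>\<theta>\<bar>) / 2 * mgf q n \<theta> \<le> A n" by (simp add: mgf_def)
    have "A n \<le> integral {0..1} (\<lambda>x. 2 * exp \<bar>\<theta>\<bar> * exp (\<theta> * S0 q n x))"
      unfolding A_def by (intro integral_mono_01 continuous_intros wc' mult_right_mono ew) auto
    then show "A n \<le> 2 * exp \<bar>\<theta>\<bar> * mgf q n \<theta>" by (simp add: mgf_def)
  qed
  have mgf0: "mgf q 0 \<theta> = 1" by (simp add: mgf_def S_def)
  have An_lo: "exp (- \<bar>\<theta>\<bar>) / 2 * lo ^ n \<le> A n" for n
  proof (induction n)
    case 0
    then show ?case using A_mgf(1)[of 0] mgf0 by simp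
  next
    case (Suc n)
    have "lo * (exp (- \<bar>\<theta>\<bar>) / 2 * lo ^ n) \<le> lo * A n" using lo Suc by (intro mult_left_mono) auto
    then show ?case using A_lo[of n] by (simp add: mult_ac)
  qed
  have An_hi: "A n \<le> 2 * exp \<bar>\<theta>\<bar> * hi ^ n" for n
  proof (induction n)
    case 0
    then show ?case using A_mgf(2)[of 0] mgf0 by simp
  next
    case (Suc n)
    have "hi * A n \<le> hi * (2 * exp \<bar>\<theta>\<bar> * hi ^ n)" using hi Suc by (intro mult_left_mono) auto
    then show ?case using A_hi[of n] by (simp add: mult_ac)
  qed
  \<comment> \<open>The comparison with \<open>mgf\<close> is used once at 0 and once at
    \<open>n\<close>, which squares its constant.\<close>
  have "exp (- \<bar>\<theta>\<bar>) / 2 * lo ^ n \<le> 2 * exp \<bar>\<theta>\<bar> * mgf q n \<theta>" using An_lo[of n] A_mgf(2)[of n] by linarith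
  then show "exp (- \<bar>\<theta>\<bar>) ^ 2 / 4 * lo ^ n \<le> mgf q n \<theta>"
    by (simp add: exp_minus field_simps power2_eq_square)
  have "exp (- \<bar>\<theta>\<bar>) / 2 * mgf q n \<theta> \<le> 2 * exp \<bar>\<theta>\<bar> * hi ^ n" using An_hi[of n] A_mgf(1)[of n] by linarith
  then show "mgf q n \<theta> \<le> 4 * exp \<bar>\<theta>\<bar> ^ 2 * hi ^ n"
    by (simp add: exp_minus field_simps power2_eq_square)
qed

section \<open>Asymptotics of the logarithm of the eigenvalue at 0\<close>

lemma abs_cos_series_le: "\<bar>cos_series k as x\<bar> \<le> sum_list (map abs as)"
proof (induction as arbitrary: k)
  case (Cons a as)
  have "\<bar>a * cos (2 * pi * real k * x)\<bar> \<le> \<bar>a\<bar>" by (simp add: abs_mult mult_left_le)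
  then show ?case using Cons[of "Suc k"] by simp
qed simp

lemma continuous_on_cos_series [continuous_intros]: "continuous_on A (cos_series k as)"
  by (induction as arbitrary: k) (auto intro!: continuous_intros)

lemma abs_power_sum_diff_le:
  fixes a :: "nat \<Rightarrow> real"
  assumes a: "\<And>k. k < N \<Longrightarrow> \<bar>a k\<bar> \<le> B" and \<theta>: "\<bar>\<theta>\<bar> \<le> 1" and N: "0 < N"
  shows "\<bar>(\<Sum>k<N. \<theta> ^ k * a k) - a 0\<bar> \<le> real N * B * \<bar>\<theta>\<bar>"
proof -
  obtain n where n: "N = Suc n" using N by (cases N) auto
  have B: "0 \<le> B" using a[OF N] by simp
  have "\<bar>\<Sum>k<n. \<theta> ^ Suc k * a (Suc k)\<bar> \<le> (\<Sum>k<n. \<bar>\<theta>\<bar> * B)"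
  proof (rule order_trans[OF sum_abs], rule sum_mono)
    fix k assume "k \<in> {..<n}"
    moreover have "\<bar>\<theta>\<bar> ^ Suc k \<le> \<bar>\<theta>\<bar>" using \<theta> power_decreasing[of 1 "Suc k" "\<bar>\<theta>\<bar>"] by simp
    ultimately show "\<bar>\<theta> ^ Suc k * a (Suc k)\<bar> \<le> \<bar>\<theta>\<bar> * B"
      unfolding abs_mult power_abs using a n by (intro mult_mono) auto
  qed
  also have "\<dots> \<le> real N * B * \<bar>\<theta>\<bar>"
    using mult_right_mono[of "real n" "real N" "B * \<bar>\<theta>\<bar>"] B by (simp add: n mult_ac)
  finally show ?thesis unfolding n sum.lessThan_Suc_shift by simp
qed

text \<open>Both \<open>x\<close> and \<open>x - e\<close> are at least 1/4, where the logarithm has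
  slope at most 4.\<close>

lemma abs_diff_ln_le:
  fixes x y e :: real
  assumes x: "1/2 \<le> x" and e: "0 \<le> e" "e \<le> 1/4" and y: "ln (x - e) \<le> y" "y \<le> ln (x + e)"
  shows "\<bar>y - ln x\<bar> \<le> 4 * e"
proof -
  have "ln (x + e) - ln x \<le> e / x" using ln_diff_le[of "x + e" x] x e by simp
  also have "\<dots> \<le> e / (1/4)" using x e by (intro divide_left_mono) auto
  finally have 1: "ln (x + e) - ln x \<le> 4 * e" by simp
  have "ln x - ln (x - e) \<le> e / (x - e)" using ln_diff_le[of x "x - e"] x e by simp
  also have "\<dots> \<le> e / (1/4)" using x e by (intro divide_left_mono mult_pos_pos) auto
  finally have "ln x - ln (x - e) \<le> 4 * e" by simp
  then show ?thesis using 1 y by (intro abs_leI) linarith+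
qed

text \<open>\<open>L\<close> enters only through \<open>bracket\<close>, so that the same lemma
  serves \<open>Lambda\<close> and \<open>Lambda_tilde\<close>. Since the series of the
  eigenfunction and of the eigenvalue both start with 1, they stay close to 1 for small \<theta>,
  and the residual can be absorbed into a perturbation of the eigenvalue.\<close>

lemma ln_eigenvalue_asymptotics:
  fixes L :: "real \<Rightarrow> real"
  assumes q: "0 < q" and N: "0 < N" "length ws = N" "length ls = N"
    and init: "ws ! 0 = [1]" "ls ! 0 = 1"
    and eig: "\<forall>k<N. eigen_coeff q ls ws k"
    and bracket: "\<And>w \<theta> lo hi. w = (\<lambda>x. \<Sum>k<N. \<theta> ^ k * cos_series 0 (ws ! k) x) \<Longrightarrow>
       (\<And>x. 1/2 \<le> w x) \<Longrightarrow> (\<And>x. w x \<le> 2) \<Longrightarrow> 0 < lo \<Longrightarrow>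
       (\<And>x. lo * w x \<le> mean_op q (\<lambda>x. exp (\<theta> * cos (2 * pi * x)) * w x) x) \<Longrightarrow>
       (\<And>x. mean_op q (\<lambda>x. exp (\<theta> * cos (2 * pi * x)) * w x) x \<le> hi * w x) \<Longrightarrow>
       ln lo \<le> L \<theta> \<and> L \<theta> \<le> ln hi"
  shows "(\<lambda>\<theta>. L \<theta> - ln (\<Sum>k<N. \<theta> ^ k * ls ! k)) \<in> O[at 0](\<lambda>\<theta>. \<theta> ^ N)"
proof -
  define B where "B = (\<Sum>k<N. sum_list (map abs (ws ! k)))"
  have fB: "\<bar>cos_series 0 (ws ! k) x\<bar> \<le> B" if "k < N" for k x
  proof -
    have "sum_list (map abs (ws ! k)) \<le> B"
      unfolding B_def using that by (intro member_le_sum) (auto intro!: sum_list_nonneg)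
    then show ?thesis using abs_cos_series_le order_trans by blast
  qed
  define A where "A = (\<Sum>k<N. \<bar>ls ! k\<bar>)"
  have lA: "\<bar>ls ! k\<bar> \<le> A" if "k < N" for k
    unfolding A_def using that by (intro member_le_sum) auto
  have AB: "0 \<le> A" "0 \<le> B"
    using fB[OF N(1), of 0] lA[OF N(1)] by (meson abs_ge_zero order_trans)+
  have coeffs: "mean_op q (\<lambda>x. \<Sum>j\<le>k. cos (2 * pi * x) ^ j / fact j * cos_series 0 (ws ! (k - j)) x) x =
        (\<Sum>j\<le>k. ls ! j * cos_series 0 (ws ! (k - j)) x)" if "k < N" for k x
    using that N eig by (intro eigen_coeff_imp[OF q]) auto
  obtain C where C: "0 \<le> C" "\<And>\<theta> x. \<bar>\<theta>\<bar> \<le> 1 \<Longrightarrow>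
     \<bar>mean_op q (\<lambda>x. exp (\<theta> * cos (2 * pi * x)) * (\<Sum>k<N. \<theta> ^ k * cos_series 0 (ws ! k) x)) x
       - (\<Sum>k<N. \<theta> ^ k * ls ! k) * (\<Sum>k<N. \<theta> ^ k * cos_series 0 (ws ! k) x)\<bar> \<le> C * \<bar>\<theta>\<bar> ^ N"
    using eigen_residual_bound[OF q, of N "\<lambda>k. cos_series 0 (ws ! k)" B "(!) ls", OF fB coeffs] by blast
  \<comment> \<open>For \<open>\<bar>\<theta>\<bar> < 1 / D\<close> the eigenfunction and the
    eigenvalue differ from 1 by at most 1/2, \<open>e\<close> is at most 1/4, and \<theta> lies in
    the unit interval.\<close>
  define D where "D = 2 * (real N * B) + 2 * (real N * A) + 8 * C + 1"
  have D: "1 \<le> D" "2 * (real N * B) \<le> D" "2 * (real N * A) \<le> D" "8 * C \<le> D"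
    using AB C(1) by (auto simp: D_def)
  have main: "\<bar>L \<theta> - ln (\<Sum>k<N. \<theta> ^ k * ls ! k)\<bar> \<le> 8 * C * \<bar>\<theta>\<bar> ^ N" if \<theta>: "\<bar>\<theta>\<bar> < 1 / D" for \<theta>
  proof -
    define w where "w = (\<lambda>x. \<Sum>k<N. \<theta> ^ k * cos_series 0 (ws ! k) x)"
    define lam where "lam = (\<Sum>k<N. \<theta> ^ k * ls ! k)"
    \<comment> \<open>The factor 2 compensates for \<open>w x \<ge> 1/2\<close>: the residual is
      then at most \<open>e * w x\<close>.\<close>
    define e where "e = 2 * C * \<bar>\<theta>\<bar> ^ N"
    have sm: "c * \<bar>\<theta>\<bar> \<le> 1/2" if "2 * c \<le> D" "0 \<le> c" for c
    proof -
      have "2 * c * \<bar>\<theta>\<bar> \<le> D * (1 / D)" using that \<theta> D(1) by (intro mult_mono) auto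
      then show ?thesis using D(1) by simp
    qed
    have "1 / D \<le> 1" using D(1) by simp
    then have \<theta>1: "\<bar>\<theta>\<bar> \<le> 1" using \<theta> by linarith
    have w1: "1/2 \<le> w x" "w x \<le> 2" for x
    proof -
      have "\<bar>w x - 1\<bar> \<le> real N * B * \<bar>\<theta>\<bar>"
        using abs_power_sum_diff_le[of N "\<lambda>k. cos_series 0 (ws ! k) x" B \<theta>] fB \<theta>1 N init by (simp add: w_def)
      also have "\<dots> \<le> 1/2" using D AB by (intro sm) auto
      finally show "1/2 \<le> w x" "w x \<le> 2" by linarith+
    qed
    have "\<bar>lam - 1\<bar> \<le> real N * A * \<bar>\<theta>\<bar>"
      using abs_power_sum_diff_le[of N "(!) ls" A \<theta>] lA \<theta>1 N init by (simp add: lam_def)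
    also have "\<dots> \<le> 1/2" using D AB by (intro sm) auto
    finally have lam: "1/2 \<le> lam" by linarith
    have "\<bar>\<theta>\<bar> ^ N \<le> \<bar>\<theta>\<bar>" using N(1) \<theta>1 power_decreasing[of 1 N "\<bar>\<theta>\<bar>"] by simp
    then have "2 * e \<le> 4 * C * \<bar>\<theta>\<bar>" using C(1) by (simp add: e_def mult_left_mono)
    also have "\<dots> \<le> 1/2" using D C(1) by (intro sm) auto
    finally have e: "0 \<le> e" "e \<le> 1/4" using C(1) by (auto simp: e_def)
    have ew: "C * \<bar>\<theta>\<bar> ^ N \<le> e * w x" for x
      using mult_left_mono[OF w1(1) e(1), of x] by (simp add: e_def)
    have res: "\<bar>mean_op q (\<lambda>x. exp (\<theta> * cos (2 * pi * x)) * w x) x - lam * w x\<bar> \<le> e * w x" for x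
      using order_trans[OF C(2)[OF \<theta>1, of x] ew[of x]] by (simp add: w_def lam_def)
    have "ln (lam - e) \<le> L \<theta> \<and> L \<theta> \<le> ln (lam + e)"
    proof (rule bracket[OF w_def])
      fix x
      show "(lam - e) * w x \<le> mean_op q (\<lambda>x. exp (\<theta> * cos (2 * pi * x)) * w x) x"
        "mean_op q (\<lambda>x. exp (\<theta> * cos (2 * pi * x)) * w x) x \<le> (lam + e) * w x"
        using res[of x] by (auto simp: algebra_simps abs_le_iff)
    qed (use w1 lam e in auto)
    then have "\<bar>L \<theta> - ln lam\<bar> \<le> 4 * e" using abs_diff_ln_le[OF lam e] by blast
    then show ?thesis by (simp add: lam_def e_def)
  qed
  have "\<forall>\<^sub>F \<theta> in at 0. \<bar>\<theta>\<bar> < 1 / D"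
  proof -
    have "eventually (\<lambda>\<theta>::real. dist \<theta> 0 < 1 / D) (at 0)"
      unfolding eventually_at using D(1) by (intro exI[of _ "1 / D"]) simp
    then show ?thesis by (simp add: dist_norm)
  qed
  then have "\<forall>\<^sub>F \<theta> in at 0. norm (L \<theta> - ln (\<Sum>k<N. \<theta> ^ k * ls ! k)) \<le> 8 * C * norm (\<theta> ^ N)"
  proof eventually_elim
    case (elim \<theta>)
    show ?case unfolding real_norm_def power_abs by (rule main[OF elim])
  qed
  then show ?thesis by (rule bigoI)
qed

section \<open>Scaling inequalities and brackets for the cumulant generating functions\<close>

lemma Lambda_eq_lim_mgf:
  assumes "U \<in> borel_measurable M" "distr M borel U = uniform_measure lborel {0..1}"
  shows "(\<integral>\<omega>. exp (\<theta> * S U q n \<omega>) \<partial>M) = mgf q n \<theta>"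
    and "Lambda M U q \<theta> = lim (\<lambda>n. ln (mgf q n \<theta>) / real n)"
proof -
  show *: "(\<integral>\<omega>. exp (\<theta> * S U q n \<omega>) \<partial>M) = mgf q n \<theta>" for n
  proof -
    have "continuous_on UNIV (\<lambda>x. exp (\<theta> * S0 q n x))" by (intro continuous_intros)
    from expectation_uniform[OF assms this] show ?thesis by (simp only: S_def mgf_def)
  qed
  show "Lambda M U q \<theta> = lim (\<lambda>n. ln (mgf q n \<theta>) / real n)"
    by (simp add: Lambda_def *)
qed

text \<open>Jensen's inequality for the \<open>p\<close>-th power applied to
  \<open>exp (\<theta> * X \<omega>)\<close>; it supplies the hypothesis \<open>Lmult\<close> of
  \<open>legendre_expansion\<close>.\<close>

lemma (in prob_space) expectation_exp_power_le:
  assumes X: "X \<in> borel_measurable M" "\<And>\<omega>. \<bar>X \<omega>\<bar> \<le> B" and p: "0 < p"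
  shows "expectation (\<lambda>\<omega>. exp (\<theta> * X \<omega>)) ^ p \<le> expectation (\<lambda>\<omega>. exp (real p * \<theta> * X \<omega>))"
proof -
  have int: "integrable M (\<lambda>\<omega>. exp (c * X \<omega>))" for c
  proof (rule integrable_const_bound[where B = "exp (\<bar>c\<bar> * B)"])
    have "c * X \<omega> \<le> \<bar>c\<bar> * B" for \<omega>
      using mult_mono[of "\<bar>c\<bar>" "\<bar>c\<bar>" "\<bar>X \<omega>\<bar>" B] X(2)[of \<omega>] abs_ge_self[of "c * X \<omega>"] by (simp add: abs_mult)
    then show "AE \<omega> in M. norm (exp (c * X \<omega>)) \<le> exp (\<bar>c\<bar> * B)" by simp
  qed (use X in measurable)
  have pw: "exp (real p * \<theta> * X \<omega>) = exp (\<theta> * X \<omega>) powr real p" for \<omega>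
    by (simp add: powr_def mult_ac)
  have "expectation (\<lambda>\<omega>. exp (\<theta> * X \<omega>)) powr real p \<le> expectation (\<lambda>\<omega>. exp (\<theta> * X \<omega>) powr real p)"
  proof (rule jensens_inequality[where I = "{0<..}"])
    show "integrable M (\<lambda>\<omega>. exp (\<theta> * X \<omega>) powr real p)" using int[of "real p * \<theta>"] by (simp add: pw)
    show "convex_on {0<..} (\<lambda>x. x powr real p)" using p by (intro powr_convex) auto
  qed (use int in auto)
  moreover have "0 < expectation (\<lambda>\<omega>. exp (\<theta> * X \<omega>))"
    using integral_less_AE_space[of "\<lambda>_. 0" "\<lambda>\<omega>. exp (\<theta> * X \<omega>)"] int by (simp add: emeasure_space_1)
  ultimately show ?thesis by (simp add: pw powr_realpow)
qed

lemma Lambda_tilde_eq: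
  assumes "U \<in> borel_measurable M" "distr M borel U = uniform_measure lborel {0..1}"
  shows "(\<integral>\<omega>. exp (\<theta> * cos (2 * pi * U \<omega>)) \<partial>M) = integral {0..1} (\<lambda>x. exp (\<theta> * cos (2 * pi * x)))"
  by (rule expectation_uniform[OF assms]) (intro continuous_intros)

lemma Lambda_tilde_ge_multiple:
  assumes M: "prob_space M" and U: "U \<in> borel_measurable M" and p: "0 < p"
    and D: "distr M borel U = uniform_measure lborel {0..1}"
  shows "real p * Lambda_tilde M U \<theta> \<le> Lambda_tilde M U (real p * \<theta>)"
proof -
  let ?E = "\<lambda>\<theta>. \<integral>\<omega>. exp (\<theta> * cos (2 * pi * U \<omega>)) \<partial>M"
  have pos: "0 < ?E \<theta>" for \<theta>
    \<comment> \<open>For \<open>q = 1\<close> and \<open>n = 1\<close> the sum \<open>S\<close> is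
      the single cosine of 2 pi U.\<close>
    using mgf_pos[of 1 1 \<theta>] unfolding Lambda_eq_lim_mgf(1)[OF U D, symmetric] by (simp add: S_def)
  have "?E \<theta> ^ p \<le> ?E (real p * \<theta>)"
    using U p by (intro prob_space.expectation_exp_power_le[OF M, where B = 1]) auto
  then have "ln (?E \<theta> ^ p) \<le> ln (?E (real p * \<theta>))" using pos by (intro ln_mono) auto
  then show ?thesis using pos by (simp add: Lambda_tilde_def ln_realpow)
qed

lemma Lambda_ge_multiple:
  assumes M: "prob_space M" and U: "U \<in> borel_measurable M" and p: "0 < p" and q: "2 \<le> q"
    and D: "distr M borel U = uniform_measure lborel {0..1}"
  shows "real p * Lambda M U q \<theta> \<le> Lambda M U q (real p * \<theta>)"
proof -
  have conv: "(\<lambda>n. ln (mgf q n \<theta>) / real n) \<longlonglongrightarrow> Lambda M U q \<theta>" for \<theta>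
    unfolding Lambda_eq_lim_mgf(2)[OF U D] using convergent_ln_mgf[OF q] by (rule convergent_LIMSEQ_iff[THEN iffD1])
  have "real p * (ln (mgf q n \<theta>) / real n) \<le> ln (mgf q n (real p * \<theta>)) / real n" for n
  proof -
    have "mgf q n \<theta> ^ p \<le> mgf q n (real p * \<theta>)"
      unfolding Lambda_eq_lim_mgf(1)[OF U D, symmetric]
    proof (rule prob_space.expectation_exp_power_le[OF M _ _ p])
      show "S U q n \<in> borel_measurable M" unfolding S_def[abs_def] using U by measurable
      show "\<bar>S U q n \<omega>\<bar> \<le> real n" for \<omega> using abs_S0_le[of q n "U \<omega>"] by (simp add: S_def)
    qed
    then have "ln (mgf q n \<theta> ^ p) \<le> ln (mgf q n (real p * \<theta>))" using mgf_pos by (intro ln_mono) auto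
    then have "real p * ln (mgf q n \<theta>) \<le> ln (mgf q n (real p * \<theta>))" using mgf_pos by (simp add: ln_realpow)
    then show ?thesis by (simp add: divide_right_mono)
  qed
  then show ?thesis
    by (intro LIMSEQ_le[OF tendsto_mult[OF tendsto_const conv] conv]) auto
qed

text \<open>The prefactors in \<open>mgf_growth\<close> do not depend on \<open>n\<close>, so they
  vanish from the logarithm divided by \<open>n\<close> in the limit.\<close>

lemma Lambda_bracket:
  assumes U: "U \<in> borel_measurable M" and D: "distr M borel U = uniform_measure lborel {0..1}"
    and q: "2 \<le> q" and wc: "continuous_on UNIV w"
    and w: "\<And>x. 1/2 \<le> w x" "\<And>x. w x \<le> 2" and lo: "0 < lo"
    and le: "\<And>x. lo * w x \<le> mean_op q (\<lambda>x. exp (\<theta> * cos (2 * pi * x)) * w x) x"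
      "\<And>x. mean_op q (\<lambda>x. exp (\<theta> * cos (2 * pi * x)) * w x) x \<le> hi * w x"
  shows "ln lo \<le> Lambda M U q \<theta> \<and> Lambda M U q \<theta> \<le> ln hi"
proof -
  have conv: "(\<lambda>n. ln (mgf q n \<theta>) / real n) \<longlonglongrightarrow> Lambda M U q \<theta>"
    unfolding Lambda_eq_lim_mgf(2)[OF U D] using convergent_ln_mgf[OF q] by (rule convergent_LIMSEQ_iff[THEN iffD1])
  have w0: "0 < w 0" using w(1)[of 0] by simp
  then have "0 < lo * w 0" using lo by simp
  also have "\<dots> \<le> hi * w 0" using le[of 0] by (rule order_trans)
  finally have hi: "0 < hi" using w0 by (simp add: zero_less_mult_iff)
  have lim: "(\<lambda>n. ln c / real n + ln b) \<longlonglongrightarrow> ln b" for c b :: real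
    using tendsto_add[OF lim_const_over_n[of "ln c"] tendsto_const[of "ln b"]] by simp
  have lnp: "ln (c * b ^ n) / real n = ln c / real n + ln b" if "0 < c" "0 < b" "1 \<le> n" for c b :: real and n
    using that by (simp add: ln_mult_pos ln_realpow add_divide_distrib)
  have "ln lo \<le> Lambda M U q \<theta>"
  proof (rule LIMSEQ_le[OF lim conv], intro exI allI impI)
    fix n :: nat assume "1 \<le> n"
    moreover have "ln (exp (- \<bar>\<theta>\<bar>) ^ 2 / 4 * lo ^ n) \<le> ln (mgf q n \<theta>)"
      using mgf_growth(1)[OF q wc w lo le] lo by (intro ln_mono mult_pos_pos) auto
    ultimately show "ln (exp (- \<bar>\<theta>\<bar>) ^ 2 / 4) / real n + ln lo \<le> ln (mgf q n \<theta>) / real n"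
      using lo by (subst lnp[symmetric]) (auto intro: divide_right_mono)
  qed
  moreover have "Lambda M U q \<theta> \<le> ln hi"
  proof (rule LIMSEQ_le[OF conv lim], intro exI allI impI)
    fix n :: nat assume "1 \<le> n"
    moreover have "ln (mgf q n \<theta>) \<le> ln (4 * exp \<bar>\<theta>\<bar> ^ 2 * hi ^ n)"
      using mgf_growth(2)[OF q wc w lo le] mgf_pos by (intro ln_mono) auto
    ultimately show "ln (mgf q n \<theta>) / real n \<le> ln (4 * exp \<bar>\<theta>\<bar> ^ 2) / real n + ln hi"
      using hi by (subst lnp[symmetric]) (auto intro: divide_right_mono)
  qed
  ultimately show ?thesis ..
qed

subsection \<open>The expansions\<close>

lemma poly_Poly: "poly (Poly as) (x::real) = (\<Sum>k<length as. x ^ k * as ! k)"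
  by (induction as)
    (auto simp: sum.lessThan_Suc_shift sum_distrib_left mult_ac simp del: sum.lessThan_Suc)

lemma Lambda_expansion:
  assumes U: "U \<in> borel_measurable M" and D: "distr M borel U = uniform_measure lborel {0..1}"
    and q: "2 \<le> q" and N: "0 < N" "length ws = N" "length ls = N"
    and init: "ws ! 0 = [1]" "ls ! 0 = 1"
    and eig: "\<forall>k<N. eigen_coeff q ls ws k"
    and P: "(\<lambda>\<theta>. ln (poly (Poly ls) \<theta>) - poly P \<theta>) \<in> O[at 0](\<lambda>\<theta>. \<theta> ^ N)"
  shows "(\<lambda>\<theta>. Lambda M U q \<theta> - poly P \<theta>) \<in> O[at 0](\<lambda>\<theta>. \<theta> ^ N)"
proof -
  have "(\<lambda>\<theta>. Lambda M U q \<theta> - ln (\<Sum>k<N. \<theta> ^ k * ls ! k)) \<in> O[at 0](\<lambda>\<theta>. \<theta> ^ N)"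
  proof (rule ln_eigenvalue_asymptotics[OF _ N init eig])
    fix w \<theta> lo hi
    assume w: "w = (\<lambda>x. \<Sum>k<N. \<theta> ^ k * cos_series 0 (ws ! k) x)"
      and *: "\<And>x. 1/2 \<le> w x" "\<And>x. w x \<le> 2" "0 < lo"
        "\<And>x. lo * w x \<le> mean_op q (\<lambda>x. exp (\<theta> * cos (2 * pi * x)) * w x) x"
        "\<And>x. mean_op q (\<lambda>x. exp (\<theta> * cos (2 * pi * x)) * w x) x \<le> hi * w x"
    have "continuous_on UNIV w" unfolding w by (intro continuous_intros)
    from Lambda_bracket[OF U D q this *] show "ln lo \<le> Lambda M U q \<theta> \<and> Lambda M U q \<theta> \<le> ln hi" .
  qed (use q in simp)
  from sum_in_bigo(1)[OF this P] show ?thesis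
    using N by (simp add: poly_Poly)
qed

lemma I_expansion:
  assumes M: "prob_space M" and U: "U \<in> borel_measurable M"
    and D: "distr M borel U = uniform_measure lborel {0..1}" and q: "2 \<le> q"
    and L: "(\<lambda>\<theta>. Lambda M U q \<theta> - poly P \<theta>) \<in> O[at 0](\<lambda>\<theta>. \<theta> ^ N)"
    and N: "3 \<le> N" "N \<le> 2 * m"
    and P: "coeff P 0 = 0" "coeff P 1 = 0" "coeff P 2 = 1/4"
    and T: "coeff T 0 = 0" "poly_cutoff N (pCons 0 T - pcompose P T - J) = 0"
      "poly_cutoff m ([:0, 1:] - pcompose (pderiv P) T) = 0"
  shows "expansion_at_0 (I M U q) (poly J) N"
proof -
  have "Lambda M U q 0 = 0"
    unfolding Lambda_eq_lim_mgf(2)[OF U D] by (simp add: mgf_def)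
  then show ?thesis unfolding I_def
    by (rule legendre_expansion[OF N P _ L Lambda_ge_multiple[OF M U _ q D] T])
qed

text \<open>These rules unroll the numeral counters, so that \<open>eigen_coeff\<close> for concrete
  lists is decided by rational arithmetic.\<close>

lemma eigen_check_simps:
  "decimate q (numeral n) (a # as) = decimate q (pred_numeral n) as"
  "(\<forall>k<numeral n. A k) \<longleftrightarrow> A (pred_numeral n) \<and> (\<forall>k<pred_numeral n. A k)"
  by (auto simp: numeral_eq_Suc less_Suc_eq)


text \<open>The lists \<open>ls\<close> and \<open>ws\<close> below solve the eigenvalue equation order by order, with every
  \<open>w\<^sub>k\<close>, \<open>k \<ge> 1\<close>, of mean zero; \<open>P\<close> is the expansion of \<open>ln \<lambda>\<close> and \<open>T\<close> the truncated
  compositional inverse of \<open>P'\<close>.\<close>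

lemma I_expansion_two:
  assumes M: "prob_space M" and U: "U \<in> borel_measurable M"
    and D: "distr M borel U = uniform_measure lborel {0..1}"
  shows "expansion_at_0 (I M U 2) (poly [:0, 0, 1, -1, 3/2, -13/6, 29/9, -23/5, 1127/180, -29083/3780, 12077/1575:]) 11"
\<comment> \<open>\<open>T\<close> inverts the derivative of \<open>P\<close> only up to order 6,
  which is enough because 11 \<le> 2 * 6.\<close>
proof (rule I_expansion[OF M U D,
      where P = "[:0, 0, 1/4, 1/8, 3/64, -1/384, -115/4608, -131/5120, -3371/245760, 17881/30965760, 2033449/206438400:]"
        and T = "[:0, 2, -3, 6, -65/6, 58/3:]"
        and m = 6])
  show "(\<lambda>\<theta>. Lambda M U 2 \<theta> - poly [:0, 0, 1/4, 1/8, 3/64, -1/384, -115/4608, -131/5120, -3371/245760, 17881/30965760, 2033449/206438400:] \<theta>) \<in> O[at 0](\<lambda>\<theta>. \<theta> ^ 11)"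
  proof (rule Lambda_expansion[OF U D,
      where ls = "[1, 0, 1/4, 1/8, 5/64, 11/384, -13/4608, -253/15360, -11503/737280, -217571/30965760, 152093/68812800]"
        and ws = "[[1], [], [0, 1/4], [0, 1/8], [0, 5/192, 1/192], [0, -3/128, 1/192], [0, -149/3840, 17/7680, 1/23040], [0, -341/11520, -1/2880, 1/15360], [0, -16151/1720320, -2641/1720320, 19/516096, 1/5160960], [0, 12623/1474560, -7589/5160960, 41/15482880, 1/2580480], [0, 9575/580608, -7319/10616832, -1/57344, 7/26542080, 1/1857945600]]"])
    show "\<forall>k<11. eigen_coeff 2 [1, 0, 1/4, 1/8, 5/64, 11/384, -13/4608, -253/15360, -11503/737280, -217571/30965760, 152093/68812800] [[1], [], [0, 1/4], [0, 1/8], [0, 5/192, 1/192], [0, -3/128, 1/192], [0, -149/3840, 17/7680, 1/23040], [0, -341/11520, -1/2880, 1/15360], [0, -16151/1720320, -2641/1720320, 19/516096, 1/5160960], [0, 12623/1474560, -7589/5160960, 41/15482880, 1/2580480], [0, 9575/580608, -7319/10616832, -1/57344, 7/26542080, 1/1857945600]] k"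
      by (simp add: eigen_coeff_def eigen_check_simps)
    show "(\<lambda>\<theta>::real. ln (poly (Poly [1, 0, 1/4, 1/8, 5/64, 11/384, -13/4608, -253/15360, -11503/737280, -217571/30965760, 152093/68812800]) \<theta>)
        - poly [:0, 0, 1/4, 1/8, 3/64, -1/384, -115/4608, -131/5120, -3371/245760, 17881/30965760, 2033449/206438400:] \<theta>) \<in> O[at 0](\<lambda>\<theta>. \<theta> ^ 11)"
      unfolding Poly.simps cCons_not_0_eq poly_pCons poly_0 by real_asymp
  qed simp_all
qed (simp_all add: numeral_2_eq_2 pcompose_pCons pderiv_pCons poly_cutoff_simps)


text \<open>For odd \<open>q\<close> the shift of x by 1/2 reverses the sign of \<open>S0\<close>,
  so odd powers are absent and the error after order 10 is already of order 12.\<close>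

lemma I_expansion_three:
  assumes M: "prob_space M" and U: "U \<in> borel_measurable M"
    and D: "distr M borel U = uniform_measure lborel {0..1}"
  shows "expansion_at_0 (I M U 3) (poly [:0, 0, 1, 0, -1/12, 0, 1/6, 0, -39/320, 0, 18113/100800:]) 12"
proof (rule I_expansion[OF M U D,
      where P = "[:0, 0, 1/4, 0, 1/192, 0, -5/2304, 0, -89/737280, 0, 80303/928972800:]"
        and T = "[:0, 2, 0, -1/3, 0, 1:]"
        and m = 6])
  show "(\<lambda>\<theta>. Lambda M U 3 \<theta> - poly [:0, 0, 1/4, 0, 1/192, 0, -5/2304, 0, -89/737280, 0, 80303/928972800:] \<theta>) \<in> O[at 0](\<lambda>\<theta>. \<theta> ^ 12)"
  proof (rule Lambda_expansion[OF U D,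
      where ls = "[1, 0, 1/4, 0, 7/192, 0, 1/576, 0, -239/737280, 0, 1039/464486400, 0]"
        and ws = "[[1], [], [], [0, 1/24], [], [0, -1/384], [0, 0, 1/23040], [0, -13/23040], [0, 0, 1/645120], [0, 1535/18579456, 0, 1/92897280], [0, 0, -247/123863040], [0, 8971/464486400, 0, 1/619315200]]"])
    show "\<forall>k<12. eigen_coeff 3 [1, 0, 1/4, 0, 7/192, 0, 1/576, 0, -239/737280, 0, 1039/464486400, 0] [[1], [], [], [0, 1/24], [], [0, -1/384], [0, 0, 1/23040], [0, -13/23040], [0, 0, 1/645120], [0, 1535/18579456, 0, 1/92897280], [0, 0, -247/123863040], [0, 8971/464486400, 0, 1/619315200]] k"
      by (simp add: eigen_coeff_def eigen_check_simps)
    show "(\<lambda>\<theta>::real. ln (poly (Poly [1, 0, 1/4, 0, 7/192, 0, 1/576, 0, -239/737280, 0, 1039/464486400, 0]) \<theta>)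
        - poly [:0, 0, 1/4, 0, 1/192, 0, -5/2304, 0, -89/737280, 0, 80303/928972800:] \<theta>) \<in> O[at 0](\<lambda>\<theta>. \<theta> ^ 12)"
      unfolding Poly.simps cCons_not_0_eq poly_pCons poly_0 by real_asymp
  qed simp_all
qed (simp_all add: numeral_2_eq_2 pcompose_pCons pderiv_pCons poly_cutoff_simps)


text \<open>The first nonconstant harmonic to survive averaging is frequency 4 in the fourth power
  of the cosine. The eigenfunction therefore leaves 1 at order 4, and the eigenvalue leaves the
  independent case at order 5.\<close>

lemma I_expansion_four:
  assumes M: "prob_space M" and U: "U \<in> borel_measurable M"
    and D: "distr M borel U = uniform_measure lborel {0..1}"
  shows "expansion_at_0 (I M U 4) (poly [:0, 0, 1, 0, 1/4, -1/12, 5/36:]) 7"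
proof (rule I_expansion[OF M U D,
      where P = "[:0, 0, 1/4, 0, -1/64, 1/384, 1/576:]"
        and T = "[:0, 2, 0, 1:]"
        and m = 4])
  show "(\<lambda>\<theta>. Lambda M U 4 \<theta> - poly [:0, 0, 1/4, 0, -1/64, 1/384, 1/576:] \<theta>) \<in> O[at 0](\<lambda>\<theta>. \<theta> ^ 7)"
  proof (rule Lambda_expansion[OF U D,
      where ls = "[1, 0, 1/4, 0, 1/64, 1/384, 1/2304]"
        and ws = "[[1], [], [], [], [0, 1/192], [], [0, -1/960]]"])
    show "\<forall>k<7. eigen_coeff 4 [1, 0, 1/4, 0, 1/64, 1/384, 1/2304] [[1], [], [], [], [0, 1/192], [], [0, -1/960]] k"
      by (simp add: eigen_coeff_def eigen_check_simps)
    show "(\<lambda>\<theta>::real. ln (poly (Poly [1, 0, 1/4, 0, 1/64, 1/384, 1/2304]) \<theta>)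
        - poly [:0, 0, 1/4, 0, -1/64, 1/384, 1/576:] \<theta>) \<in> O[at 0](\<lambda>\<theta>. \<theta> ^ 7)"
      unfolding Poly.simps cCons_not_0_eq poly_pCons poly_0 by real_asymp
  qed simp_all
qed (simp_all add: numeral_2_eq_2 pcompose_pCons pderiv_pCons poly_cutoff_simps)


text \<open>Up to order 5 the independent case agrees with \<open>q = 6\<close>, whose approximate eigenfunction is
  the constant 1.\<close>

lemma I_tilde_expansion:
  assumes M: "prob_space M" and U: "U \<in> borel_measurable M"
    and D: "distr M borel U = uniform_measure lborel {0..1}"
  shows "expansion_at_0 (I_tilde M U) (poly [:0, 0, 1, 0, 1/4:]) 6"
proof -
  let ?ls = "[1, 0, 1/4, 0, 1/64, 0] :: real list"
  let ?ws = "[[1], [], [], [], [], []] :: real list list"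
  let ?P = "[:0, 0, 1/4, 0, -1/64:] :: real poly"
  have 1: "(\<lambda>\<theta>. Lambda_tilde M U \<theta> - ln (\<Sum>k<6. \<theta> ^ k * ?ls ! k)) \<in> O[at 0](\<lambda>\<theta>. \<theta> ^ 6)"
  proof (rule ln_eigenvalue_asymptotics)
    \<comment> \<open>Powers of the cosine up to the fifth contain no positive frequency divisible
      by 6, so the constant 1 passes every check.\<close>
    show "\<forall>k<6. eigen_coeff 6 ?ls ?ws k"
      by (simp add: eigen_coeff_def eigen_check_simps)
    fix w \<theta> lo hi
    assume w: "w = (\<lambda>x. \<Sum>k<6. \<theta> ^ k * cos_series 0 (?ws ! k) x)" and lo: "0 < lo"
      and le: "\<And>x. lo * w x \<le> mean_op 6 (\<lambda>x. exp (\<theta> * cos (2 * pi * x)) * w x) x"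
        "\<And>x. mean_op 6 (\<lambda>x. exp (\<theta> * cos (2 * pi * x)) * w x) x \<le> hi * w x"
    define F where "F = (\<lambda>x. exp (\<theta> * cos (2 * pi * x)))"
    have w1: "w = (\<lambda>_. 1)" by (simp add: w numeral_eq_Suc)
    have Fc: "continuous_on A F" for A unfolding F_def by (intro continuous_intros)
    have mc: "continuous_on A (mean_op 6 F)" for A by (rule continuous_on_mean_op[OF Fc]) simp
    \<comment> \<open>Averaging preserves the integral, so the pointwise bracket for w = 1 encloses
      the integral of \<open>F\<close>, whose logarithm is \<open>Lambda_tilde\<close>.\<close>
    have "integral {0..1} F = integral {0..1} (mean_op 6 F)"
      using integral_mult_periodic[of 6 F "\<lambda>_. 1"] Fc by simp
    moreover have "integral {0..1::real} (\<lambda>_. lo) \<le> integral {0..1} (mean_op 6 F)"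
      using le(1) by (intro integral_mono_01 mc) (auto simp: w1 F_def)
    moreover have "integral {0..1} (mean_op 6 F) \<le> integral {0..1::real} (\<lambda>_. hi)"
      using le(2) by (intro integral_mono_01 mc) (auto simp: w1 F_def)
    ultimately have "lo \<le> integral {0..1} F" "integral {0..1} F \<le> hi" by simp_all
    then show "ln lo \<le> Lambda_tilde M U \<theta> \<and> Lambda_tilde M U \<theta> \<le> ln hi"
      unfolding Lambda_tilde_def Lambda_tilde_eq[OF U D] F_def using lo by (auto intro!: ln_mono)
  qed simp_all
  have 2: "(\<lambda>\<theta>. ln (poly (Poly ?ls) \<theta>) - poly ?P \<theta>) \<in> O[at 0](\<lambda>\<theta>. \<theta> ^ 6)"
    unfolding Poly.simps cCons_not_0_eq poly_pCons poly_0 by real_asymp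
  have "poly (Poly ?ls) \<theta> = (\<Sum>k<6. \<theta> ^ k * ?ls ! k)" for \<theta>
    unfolding poly_Poly by (rule sum.cong) simp_all
  with sum_in_bigo(1)[OF 1 2] have L: "(\<lambda>\<theta>. Lambda_tilde M U \<theta> - poly ?P \<theta>) \<in> O[at 0](\<lambda>\<theta>. \<theta> ^ 6)"
    by (simp del: Poly.simps)
  have L0: "Lambda_tilde M U 0 = 0"
    unfolding Lambda_tilde_def Lambda_tilde_eq[OF U D] by simp
  show ?thesis unfolding I_tilde_def
    by (rule legendre_expansion[OF _ _ _ _ _ L0 L Lambda_tilde_ge_multiple[OF M U _ D],
          where M = 3 and T = "[:0, 2:]"])
      (simp_all add: numeral_2_eq_2 pcompose_pCons pderiv_pCons poly_cutoff_simps)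
qed


text \<open>Equal functions would force \<open>p z - p' z\<close> to be of order
  \<open>Suc k\<close>, so its quotient by \<open>z ^ k\<close> would tend to 0 rather than to
  \<open>c\<close>.\<close>

lemma expansions_imp_neq:
  assumes f: "expansion_at_0 f p N" and g: "expansion_at_0 g p' N'"
    and k: "k < N" "k < N'" and lim: "((\<lambda>z. (p z - p' z) / z ^ k) \<longlongrightarrow> c) (at 0)" and c: "c \<noteq> 0"
  shows "f \<noteq> g"
proof
  assume eq: "f = g"
  have pow: "(\<lambda>z::real. z ^ n) \<in> O[at 0](\<lambda>z. z ^ Suc k)" if "k < n" for n
  proof (rule bigoI[where c = 1])
    have "eventually (\<lambda>z::real. dist z 0 < 1) (at 0)"
      unfolding eventually_at by (intro exI[of _ 1]) simp
    then show "\<forall>\<^sub>F z::real in at 0. norm (z ^ n) \<le> 1 * norm (z ^ Suc k)"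
    proof eventually_elim
      case (elim z)
      then show ?case unfolding norm_power using that by (simp only: mult_1) (intro power_decreasing, auto simp: dist_norm)
    qed
  qed
  have "(\<lambda>z. real_of_ereal (f z) - p z) \<in> O[at 0](\<lambda>z. z ^ Suc k)"
    "(\<lambda>z. real_of_ereal (f z) - p' z) \<in> O[at 0](\<lambda>z. z ^ Suc k)"
    using f g eq pow[OF k(1)] pow[OF k(2)] unfolding expansion_at_0_def by (auto intro: landau_o.big_trans)
  from sum_in_bigo(2)[OF this(2,1)] have "(\<lambda>z. p z - p' z) \<in> O[at 0](\<lambda>z. z ^ Suc k)"
    by simp
  then obtain C where C: "\<forall>\<^sub>F z in at 0. norm (p z - p' z) \<le> C * norm (z ^ Suc k)"
    by (elim landau_o.bigE)
  have "((\<lambda>z. (p z - p' z) / z ^ k) \<longlongrightarrow> 0) (at 0)"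
  proof (rule Lim_null_comparison)
    show "\<forall>\<^sub>F z in at 0. norm ((p z - p' z) / z ^ k) \<le> C * \<bar>z\<bar>"
      using C eventually_neq_at_within[of 0]
    proof eventually_elim
      case (elim z)
      then show ?case by (simp add: abs_mult field_simps)
    qed
    show "((\<lambda>z. C * \<bar>z\<bar>) \<longlongrightarrow> 0) (at 0)" by (auto intro!: tendsto_eq_intros)
  qed
  then show False using tendsto_unique[OF _ lim] c by simp
qed

theorem proposition2p4:
  fixes M :: "'a measure" and U :: "'a \<Rightarrow> real"
  assumes "prob_space M"
    and "U \<in> borel_measurable M"
    and "distr M borel U = uniform_measure lborel {0..1}"
  shows "expansion_at_0 (I M U 2)
           (\<lambda>z. z^2 - z^3 + 3 * z^4 / 2 - 13 * z^5 / 6 + 29 * z^6 / 9 - 23 * z^7 / 5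
                + 1127 * z^8 / 180 - 29083 * z^9 / 3780 + 12077 * z^10 / 1575) 11
       \<and> expansion_at_0 (I M U 3)
           (\<lambda>z. z^2 - z^4 / 12 + z^6 / 6 - 39 * z^8 / 320 + 18113 * z^10 / 100800) 12
       \<and> expansion_at_0 (I M U 4)
           (\<lambda>z. z^2 + z^4 / 4 - z^5 / 12 + 5 * z^6 / 36) 7
       \<and> distinct [I M U 2, I M U 3, I M U 4, I_tilde M U]"
proof -
  have e2: "expansion_at_0 (I M U 2)
           (\<lambda>z. z^2 - z^3 + 3 * z^4 / 2 - 13 * z^5 / 6 + 29 * z^6 / 9 - 23 * z^7 / 5
                + 1127 * z^8 / 180 - 29083 * z^9 / 3780 + 12077 * z^10 / 1575) 11" (is "expansion_at_0 _ ?p2 _")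
    by (rule back_subst[where P = "\<lambda>p. expansion_at_0 _ p _", OF I_expansion_two[OF assms]])
      (simp add: fun_eq_iff eval_nat_numeral field_simps)
  have e3: "expansion_at_0 (I M U 3)
           (\<lambda>z. z^2 - z^4 / 12 + z^6 / 6 - 39 * z^8 / 320 + 18113 * z^10 / 100800) 12" (is "expansion_at_0 _ ?p3 _")
    by (rule back_subst[where P = "\<lambda>p. expansion_at_0 _ p _", OF I_expansion_three[OF assms]])
      (simp add: fun_eq_iff eval_nat_numeral field_simps)
  have e4: "expansion_at_0 (I M U 4)
           (\<lambda>z. z^2 + z^4 / 4 - z^5 / 12 + 5 * z^6 / 36) 7" (is "expansion_at_0 _ ?p4 _")
    by (rule back_subst[where P = "\<lambda>p. expansion_at_0 _ p _", OF I_expansion_four[OF assms]])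
      (simp add: fun_eq_iff eval_nat_numeral field_simps)
  have et: "expansion_at_0 (I_tilde M U) (\<lambda>z. z^2 + z^4 / 4) 6" (is "expansion_at_0 _ ?pt _")
    by (rule back_subst[where P = "\<lambda>p. expansion_at_0 _ p _", OF I_tilde_expansion[OF assms]])
      (simp add: fun_eq_iff eval_nat_numeral field_simps)
  \<comment> \<open>The cubic term separates \<open>q = 2\<close> from the rest, the quartic term
    separates \<open>q = 3\<close> from \<open>q = 4\<close> and from the independent case, and the
    quintic term separates the last two.\<close>
  have "((\<lambda>z. (?p2 z - ?p3 z) / z ^ 3) \<longlongrightarrow> -1) (at 0)" by real_asymp
  then have "I M U 2 \<noteq> I M U 3" by (intro expansions_imp_neq[OF e2 e3]) auto
  moreover have "((\<lambda>z. (?p2 z - ?p4 z) / z ^ 3) \<longlongrightarrow> -1) (at 0)" by real_asymp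
  then have "I M U 2 \<noteq> I M U 4" by (intro expansions_imp_neq[OF e2 e4]) auto
  moreover have "((\<lambda>z. (?p2 z - ?pt z) / z ^ 3) \<longlongrightarrow> -1) (at 0)" by real_asymp
  then have "I M U 2 \<noteq> I_tilde M U" by (intro expansions_imp_neq[OF e2 et]) auto
  moreover have "((\<lambda>z. (?p3 z - ?p4 z) / z ^ 4) \<longlongrightarrow> -1/3) (at 0)" by real_asymp
  then have "I M U 3 \<noteq> I M U 4" by (intro expansions_imp_neq[OF e3 e4]) auto
  moreover have "((\<lambda>z. (?p3 z - ?pt z) / z ^ 4) \<longlongrightarrow> -1/3) (at 0)" by real_asymp
  then have "I M U 3 \<noteq> I_tilde M U" by (intro expansions_imp_neq[OF e3 et]) auto
  moreover have "((\<lambda>z. (?p4 z - ?pt z) / z ^ 5) \<longlongrightarrow> -1/12) (at 0)" by real_asymp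
  then have "I M U 4 \<noteq> I_tilde M U" by (intro expansions_imp_neq[OF e4 et]) auto
  ultimately show ?thesis using e2 e3 e4 by simp
qed

end
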